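(* The following identity holds in $\mathcal{D}'(\mathbb{R}_\omega)$: $$\sum_{N\in\mathbb{Z}}e^{-iNL(\omega)}=2\pi\sum_{k\in\mathbb{N}^*}\frac1{L'(\omega'_k)}\delta_{\omega=\omega'_k}.$$ That is, for every $\phi\in C_0^\infty(\mathbb{R})$, $$\sum_{N\in\mathbb{Z}}\int_{\mathbb{R}}e^{-iNL(\omega)}\phi(\omega)\,d\omega=2\pi\sum_{k\in\mathbb{N}^*}\frac1{L'(\omega'_k)}\phi(\omega'_k).$$
   Context: $A_\pm(z)=e^{\mp i\pi/3}\mathrm{Ai}(e^{\mp i\pi/3}z)$, so that $\mathrm{Ai}(-z)=A_+(z)+A_-(z)$ and $\mathrm{Ai}'(-z)=-(A_+'(z)+A_-'(z))$. For $\omega\in\mathbb{R}$, $$L(\omega)=\pi+i\log\Big(\frac{A_-'(\omega)}{A_+'(\omega)}\Big),$$ with a continuous branch of the logarithm along $\mathbb{R}$ (the quotient has modulus one, $L$ is real-valued, and $e^{-iNL(\omega)}=(-1)^N\big(A_-'(\omega)/A_+'(\omega)\big)^N$ does not depend on the branch). $(-\omega'_k)_{k\ge1}$ are the zeros of $\mathrm{Ai}'$ in decreasing order, $\mathrm{Ai}'(-\omega'_k)=0$. The sum over $N\in\mathbb{Z}$ is understood as the limit of symmetric partial sums in the sense of distributions; $\mathbb{N}^*=\{1,2,\dots\}$. *)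

theory Defs
  imports "HOL-Analysis.Analysis"
begin

(* The Airy function Ai by its Maclaurin series (entire; value and derivative at 0 are
   1/(3^(2/3) Gamma(2/3)) and -1/(3^(1/3) Gamma(1/3))); see airy_ode below. *)
definition airy_f :: "complex \<Rightarrow> complex" where
  "airy_f z = (\<Sum>k. 3 ^ k * pochhammer (1/3) k / fact (3*k) * z ^ (3*k))"

definition airy_g :: "complex \<Rightarrow> complex" where
  "airy_g z = (\<Sum>k. 3 ^ k * pochhammer (2/3) k / fact (3*k+1) * z ^ (3*k+1))"

definition airy :: "complex \<Rightarrow> complex" where
  "airy z = of_real (1 / (3 powr (2/3) * Gamma (2/3))) * airy_f z
          - of_real (1 / (3 powr (1/3) * Gamma (1/3))) * airy_g z"

lemma poch_rec: "3 * (r + of_nat k) * (3 ^ k * pochhammer r k) = 3 ^ Suc k * pochhammer (r::complex) (Suc k)"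
  by (simp add: pochhammer_Suc algebra_simps)

lemma airy_aux:
  fixes r :: real and j :: nat
  assumes r: "r = (1 + real j) / 3" and j: "j < 2"
  defines "c \<equiv> (\<lambda>n. if n mod 3 = j then 3 ^ (n div 3) * pochhammer (of_real r) (n div 3) / fact n else (0::complex))"
  defines "F \<equiv> (\<lambda>z. \<Sum>k. 3 ^ k * pochhammer (of_real r) k / fact (3*k+j) * z ^ (3*k+j))"
  shows "(\<lambda>n. c n * z ^ n) sums F z"
    and "\<And>n. of_nat (n+3) * of_nat (n+2) * c (n+3) = c n"
    and "c 2 = 0" and "c 0 = (if j = 0 then 1 else 0)" and "c 1 = (if j = 1 then 1 else 0)"
proof -
  have fc: "(fact (m+3) :: complex) = of_nat (m+3) * of_nat (m+2) * of_nat (m+1) * fact m" for m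
    by (simp add: numeral_3_eq_3 fact_Suc algebra_simps)
  let ?t = "\<lambda>k. 3 ^ k * pochhammer (of_real r) k / fact (3*k+j) * z ^ (3*k+j)"
  have j3: "of_nat (3*k+j+1) = 3 * (of_real r + of_nat k :: complex)" for k
    by (simp add: r distrib_left)
  have step: "?t (Suc k) = ?t k * z^3 / (of_nat (3*k+j+3) * of_nat (3*k+j+2))" for k
  proof -
    have "?t (Suc k) = 3 * (of_real r + of_nat k) * (3 ^ k * pochhammer (of_real r) k) / fact ((3*k+j)+3) * (z ^ (3*k+j) * z ^ 3)"
    proof -
      have "3 * Suc k + j = 3*k+j+3" by simp
      thus ?thesis by (simp only: poch_rec power_add)
    qed
    also have "\<dots> = of_nat (3*k+j+1) * (3 ^ k * pochhammer (of_real r) k) 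
        / (of_nat (3*k+j+3) * of_nat (3*k+j+2) * of_nat (3*k+j+1) * fact (3*k+j)) * (z ^ (3*k+j) * z ^ 3)"
      by (simp only: j3 fc)
    also have "\<dots> = ?t k * z^3 / (of_nat (3*k+j+3) * of_nat (3*k+j+2))"
    proof -
      have nz: "of_nat (3*k+j+1) \<noteq> (0::complex)" by (metis of_nat_eq_0_iff add_is_0 one_neq_zero)
      show ?thesis using nz by (simp del: of_nat_add of_nat_mult add: mult_ac)
    qed
    finally show ?thesis .
  qed
  have "summable ?t"
  proof (rule summable_ratio_test[of "1/2" "nat \<lceil>2 * norm z ^ 3\<rceil>"])
    fix k assume k: "k \<ge> nat \<lceil>2 * norm z ^ 3\<rceil>"
    hence k2: "2 * norm z ^ 3 \<le> real k" by linarith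
    have a: "real k \<le> real (3*k+j+3) * real (3*k+j+2)"
      using mult_mono[of "real k" "real (3*k+j+3)" 1 "real (3*k+j+2)"] by simp
    have pos: "0 < real (3*k+j+3) * real (3*k+j+2)" by simp
    have "norm (?t (Suc k)) = norm (?t k) * (norm z ^ 3 / (real (3*k+j+3) * real (3*k+j+2)))"
      unfolding step by (simp only: norm_mult norm_divide norm_power norm_of_nat times_divide_eq_right)
    also have "\<dots> \<le> norm (?t k) * (1/2)"
    proof (rule mult_left_mono[OF _ norm_ge_zero])
      show "norm z ^ 3 / (real (3*k+j+3) * real (3*k+j+2)) \<le> 1/2"
        unfolding pos_divide_le_eq[OF pos] using a k2 by linarith
    qed
    finally show "norm (?t (Suc k)) \<le> 1/2 * norm (?t k)" by simp
  qed simp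
  hence "?t sums F z" unfolding F_def by (rule summable_sums)
  moreover have "?t = (\<lambda>k. (\<lambda>n. c n * z ^ n) (3*k+j))"
    using j by (auto simp: c_def fun_eq_iff)
  moreover have "(\<lambda>k. (\<lambda>n. c n * z ^ n) (3*k+j)) sums F z \<longleftrightarrow> (\<lambda>n. c n * z ^ n) sums F z"
  proof (rule sums_mono_reindex)
    show "strict_mono (\<lambda>k. 3*k+j)" by (simp add: strict_mono_def)
    fix n assume "n \<notin> range (\<lambda>k. 3*k+j)"
    hence "n mod 3 \<noteq> j" by (metis mult_div_mod_eq rangeI)
    thus "c n * z ^ n = 0" by (simp add: c_def)
  qed
  ultimately show "(\<lambda>n. c n * z ^ n) sums F z" by simp
  show "of_nat (n+3) * of_nat (n+2) * c (n+3) = c n" for n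
  proof (cases "n mod 3 = j")
    case True
    define k where "k = n div 3"
    have n: "n = 3*k+j" using True k_def by (metis mult_div_mod_eq)
    have "c (n+3) = 3 * (of_real r + of_nat k) * (3 ^ k * pochhammer (of_real r) k) / fact (n+3)"
      unfolding poch_rec using True by (simp add: c_def k_def)
    also have "\<dots> = of_nat (n+1) * (3 ^ k * pochhammer (of_real r) k) / (of_nat (n+3) * of_nat (n+2) * of_nat (n+1) * fact n)"
      by (simp only: j3[symmetric] fc n)
    finally have e: "c (n+3) = \<dots>" .
    have nz: "of_nat (n+1) \<noteq> (0::complex)" "of_nat (n+2) \<noteq> (0::complex)" "of_nat (n+3) \<noteq> (0::complex)"
      unfolding of_nat_eq_0_iff by auto
    show ?thesis unfolding e using nz True by (simp del: of_nat_add add: c_def k_def)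
  next
    case False
    thus ?thesis by (simp add: c_def)
  qed
  show "c 2 = 0" "c 0 = (if j = 0 then 1 else 0)" "c 1 = (if j = 1 then 1 else 0)"
    using j by (auto simp: c_def)
qed

lemma airy_power_series:
  obtains c :: "nat \<Rightarrow> complex" where
    "\<And>z. (\<lambda>n. c n * z ^ n) sums airy z"
    "\<And>n. of_nat (n+3) * of_nat (n+2) * c (n+3) = c n" "c 2 = 0"
    "c 0 = of_real (1 / (3 powr (2/3) * Gamma (2/3)))"
    "c 1 = - of_real (1 / (3 powr (1/3) * Gamma (1/3)))"
proof -
  define p where "p = (of_real (1 / (3 powr (2/3) * Gamma (2/3))) :: complex)"
  define q where "q = (of_real (1 / (3 powr (1/3) * Gamma (1/3))) :: complex)"
  define a where "a = (\<lambda>n. if n mod 3 = 0 then 3 ^ (n div 3) * pochhammer (of_real (1/3)) (n div 3) / fact n else (0::complex))"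
  define b where "b = (\<lambda>n. if n mod 3 = 1 then 3 ^ (n div 3) * pochhammer (of_real (2/3)) (n div 3) / fact n else (0::complex))"
  have r: "1/3 = (1 + real 0) / 3" "2/3 = (1 + real 1) / 3" by simp_all
  note A = airy_aux[OF r(1)]
  note B = airy_aux[OF r(2)]
  have s: "(\<lambda>n. (p * a n - q * b n) * z ^ n) sums airy z" for z
  proof -
    have "(\<lambda>n. p * (a n * z ^ n) - q * (b n * z ^ n)) sums (p * airy_f z - q * airy_g z)"
      by (intro sums_diff sums_mult) (use A(1)[of z] B(1)[of z] in \<open>simp_all del: fact_Suc add: airy_f_def airy_g_def a_def b_def\<close>)
    thus ?thesis by (simp add: airy_def p_def q_def algebra_simps)
  qed
  have "of_nat (n+3) * of_nat (n+2) * (p * a (n+3) - q * b (n+3)) 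
      = p * (of_nat (n+3) * of_nat (n+2) * a (n+3)) - q * (of_nat (n+3) * of_nat (n+2) * b (n+3))" for n
    by (simp only: algebra_simps)
  also have "\<dots> n = p * a n - q * b n" for n by (simp only: A(2)[of n, folded a_def] B(2)[of n, folded b_def] a_def b_def)
  finally have "of_nat (n+3) * of_nat (n+2) * (p * a (n+3) - q * b (n+3)) = p * a n - q * b n" for n .
  from that[OF s this] show ?thesis using A(3-) B(3-) by (simp add: p_def q_def a_def b_def)
qed

theorem airy_ode:
  shows "airy holomorphic_on UNIV"
    and "deriv (deriv airy) z = z * airy z"
    and "airy 0 = of_real (1 / (3 powr (2/3) * Gamma (2/3)))"
    and "deriv airy 0 = - of_real (1 / (3 powr (1/3) * Gamma (1/3)))"
proof -
  obtain c :: "nat \<Rightarrow> complex" where s: "\<And>z. (\<lambda>n. c n * z ^ n) sums airy z"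
    and rec: "\<And>n. of_nat (n+3) * of_nat (n+2) * c (n+3) = c n" and c2: "c 2 = 0"
    and c0: "c 0 = of_real (1 / (3 powr (2/3) * Gamma (2/3)))"
    and c1: "c 1 = - of_real (1 / (3 powr (1/3) * Gamma (1/3)))"
    using airy_power_series by blast
  have ae: "airy = (\<lambda>z. \<Sum>n. c n * z ^ n)" using s by (auto simp: sums_iff fun_eq_iff)
  have sm: "summable (\<lambda>n. c n * z ^ n)" for z using s by (auto simp: sums_iff)
  have d1: "(airy has_field_derivative (\<Sum>n. diffs c n * z ^ n)) (at z)" for z
    unfolding ae by (rule termdiffs_strong_converges_everywhere) (rule sm)
  have sm1: "summable (\<lambda>n. diffs c n * z ^ n)" for z
    using termdiff_converges_all[of c z] sm by blast
  have e1: "deriv airy = (\<lambda>z. \<Sum>n. diffs c n * z ^ n)" using d1 DERIV_imp_deriv by blast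
  have d2: "(deriv airy has_field_derivative (\<Sum>n. diffs (diffs c) n * z ^ n)) (at z)" for z
    unfolding e1 by (rule termdiffs_strong_converges_everywhere) (rule sm1)
  have sm2: "summable (\<lambda>n. diffs (diffs c) n * z ^ n)" for z
    using termdiff_converges_all[of "diffs c" z] sm1 by blast
  show "airy holomorphic_on UNIV"
    using d1 by (auto simp: holomorphic_on_def field_differentiable_def)
  have dd: "diffs (diffs c) (Suc n) = c n" for n
    using rec[of n] by (simp add: diffs_def numeral_3_eq_3 algebra_simps)
  have dd0: "diffs (diffs c) 0 = 0" using c2 by (simp add: diffs_def numeral_2_eq_2)
  have "deriv (deriv airy) z = (\<Sum>n. diffs (diffs c) n * z ^ n)" using d2 DERIV_imp_deriv by blast
  also have "\<dots> = (\<Sum>n. diffs (diffs c) (Suc n) * z ^ Suc n)"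
    using suminf_split_head[OF sm2[of z]] dd0 by simp
  also have "\<dots> = (\<Sum>n. z * (c n * z ^ n))" by (simp add: dd algebra_simps)
  also have "\<dots> = z * airy z" unfolding ae by (rule suminf_mult[OF sm])
  finally show "deriv (deriv airy) z = z * airy z" .
  show "airy 0 = of_real (1 / (3 powr (2/3) * Gamma (2/3)))" unfolding ae by (simp add: c0)
  show "deriv airy 0 = - of_real (1 / (3 powr (1/3) * Gamma (1/3)))"
    unfolding e1 using c1 by (simp add: diffs_def)
qed

definition airy_plus :: "complex \<Rightarrow> complex" where
  "airy_plus z = exp (- \<i> * of_real pi / 3) * airy (exp (- \<i> * of_real pi / 3) * z)"

definition airy_minus :: "complex \<Rightarrow> complex" where
  "airy_minus z = exp (\<i> * of_real pi / 3) * airy (exp (\<i> * of_real pi / 3) * z)"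

(* L is complex-valued here: that the quotient has modulus one, and hence that L takes real
   values, is not built in. *)
definition airy_phase :: "(real \<Rightarrow> complex) \<Rightarrow> bool" where
  "airy_phase L \<longleftrightarrow> (\<exists>l :: real \<Rightarrow> complex. continuous_on UNIV l \<and>
     (\<forall>\<omega>. exp (l \<omega>) = deriv airy_minus (of_real \<omega>) / deriv airy_plus (of_real \<omega>)) \<and>
     (\<forall>\<omega>. L \<omega> = of_real pi + \<i> * l \<omega>))"

(* For k >= 1, minus the k-th zero of Ai' on the real line, counted from the right. *)
definition airy_deriv_zero :: "nat \<Rightarrow> real" where
  "airy_deriv_zero k = (THE x. deriv airy (of_real (- x)) = 0 \<and>
     card {y. y \<le> x \<and> deriv airy (of_real (- y)) = 0} = k)"

definition test_function :: "(real \<Rightarrow> complex) \<Rightarrow> bool" where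
  "test_function \<phi> \<longleftrightarrow>
     (\<exists>D :: nat \<Rightarrow> real \<Rightarrow> complex. D 0 = \<phi> \<and>
        (\<forall>n x. (D n has_vector_derivative D (Suc n) x) (at x))) \<and>
     compact (closure {x. \<phi> x \<noteq> 0})"

end

theory Submission
  imports Defs "HOL-Complex_Analysis.Complex_Analysis"
begin

text \<open>
  The function \<open>L\<close> takes real values; call it \<open>\<theta>\<close> as a real function. The symmetric partial sums of \<open>exp (- \<i> N \<theta>)\<close> are
  Dirichlet kernels evaluated at \<open>\<theta> \<omega>\<close>, so the statement is Poisson summation pulled back along
  \<open>\<theta>\<close>: mass concentrates at the resonances \<open>\<theta> \<omega> \<in> 2 \<pi> \<int>\<close>, and the change of variables
  produces the weight \<open>1 / \<theta>'\<close>.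

  The analytic half (\<open>phase_poisson_summation\<close>) holds for every real phase that is strictly
  increasing on the positive half-line and has neither a resonance nor, except possibly at \<open>0\<close>, a
  critical point on the other half. On an interval with a single resonance \<open>z\<close> one subtracts from
  the test function the multiple \<open>c \<theta>'\<close> that agrees with it at \<open>z\<close>. The difference divided by
  \<open>sin (\<theta> / 2)\<close> is continuous, so its contribution vanishes by a Riemann--Lebesgue lemma for
  the phase \<open>\<theta>\<close>; the contribution of \<open>c \<theta>'\<close> is an exact derivative, whose limit is
  the jump \<open>2 \<pi>\<close> of the primitive of the Dirichlet kernel. Away from resonances only the
  Riemann--Lebesgue part remains. Finitely many resonances meet the support of the test function.

  The Airy half checks the hypotheses. On the real line \<open>A\<^sub>-'\<close> is the complex conjugate of
  \<open>A\<^sub>+'\<close>, so \<open>\<theta>\<close> is real, and the constancy of the Wronskian of \<open>A\<^sub>+\<close> and \<open>A\<^sub>-\<close> gives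
  \<open>\<theta>' \<omega> = \<kappa> \<omega> / norm (A\<^sub>+' \<omega>) ^ 2\<close> with \<open>\<kappa> > 0\<close>; in particular \<open>\<theta>\<close> decreases on the
  negative axis and is stationary at \<open>0\<close>. The relation \<open>Ai (- z) = A\<^sub>+ z + A\<^sub>- z\<close> identifies the
  resonances with the zeros of \<open>Ai' (- \<omega>)\<close>. That all of them are positive is the point
  at which the decaying Airy function differs from other solutions of the Airy equation: if \<open>Ai'\<close>
  vanished at some \<open>x \<ge> 0\<close>, the differential equation would force \<open>Ai\<^sup>2\<close> to grow without bound to
  the right of \<open>x\<close>, whereas the Gamma constants in the initial values make \<open>Ai\<close> bounded there
  (\<open>airy_bounded_nonneg\<close>). Finally there are infinitely many zeros, since solutions of
  \<open>v'' = - x v\<close> oscillate, so the counting definition of the \<open>k\<close>-th zero is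
  meaningful for every \<open>k \<ge> 1\<close> and enumerates all of them.
\<close>

section \<open>Oscillatory integrals with a real phase\<close>

text \<open>
  The factor \<open>L'\<close> makes \<open>L' exp (\<i> t L)\<close> an exact derivative up to the factor \<open>\<i> t\<close>, so
  one integration by parts gains \<open>1 / t\<close> even where \<open>L'\<close> vanishes.
\<close>
lemma oscillatory_integral_by_parts:
  fixes L L' :: "real \<Rightarrow> real" and g g' :: "real \<Rightarrow> complex"
  assumes "p \<le> q" and L: "\<And>x. (L has_real_derivative L' x) (at x)"
    and L'c: "continuous_on UNIV L'"
    and g: "\<And>x. (g has_vector_derivative g' x) (at x)" and g'c: "continuous_on {p..q} g'"
  shows "((\<lambda>t::real. integral {p..q} (\<lambda>x. g x * L' x * exp (\<i> * t * L x))) \<longlongrightarrow> 0) at_infinity"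
proof -
  have Lc: "continuous_on S L" for S
    using L by (meson DERIV_isCont continuous_at_imp_continuous_on)
  have gc: "continuous_on S g" for S
    using g by (meson has_vector_derivative_continuous continuous_at_imp_continuous_on)
  have L'c': "continuous_on S L'" for S using L'c continuous_on_subset by blast
  define K where "K = norm (g q) + norm (g p) + integral {p..q} (\<lambda>x. norm (g' x))"
  have bound: "norm (integral {p..q} (\<lambda>x. g x * L' x * exp (\<i> * t * L x))) \<le> K / \<bar>t\<bar>" if t: "t \<noteq> 0" for t :: real
  proof -
    have Lv: "((\<lambda>x. of_real (L x) :: complex) has_vector_derivative of_real (L' x)) (at x)" for x
      using has_vector_derivative_of_real[OF L] .
    have ev: "((\<lambda>x. exp (\<i> * t * L x)) has_vector_derivative (\<i> * t * L' x) * exp (\<i> * t * L x)) (at x)" for x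
    proof -
      have "((\<lambda>x. \<i> * t * L x) has_vector_derivative \<i> * t * L' x) (at x)"
        by (intro has_vector_derivative_mult_right Lv)
      from field_vector_diff_chain_at[OF this DERIV_exp] show ?thesis
        by (simp add: o_def mult.commute)
    qed
    have ftc: "((\<lambda>x. g x * ((\<i> * t * L' x) * exp (\<i> * t * L x)) + g' x * exp (\<i> * t * L x))
        has_integral (g q * exp (\<i> * t * L q) - g p * exp (\<i> * t * L p))) {p..q}"
      by (rule fundamental_theorem_of_calculus[OF \<open>p \<le> q\<close>])
         (rule has_vector_derivative_at_within, rule has_vector_derivative_mult[OF g ev])
    have i2: "(\<lambda>x. g' x * exp (\<i> * t * L x)) integrable_on {p..q}"
      by (intro integrable_continuous_interval continuous_intros g'c Lc)
    have "((\<lambda>x. (\<i> * t) * (g x * L' x * exp (\<i> * t * L x))) has_integral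
        (g q * exp (\<i> * t * L q) - g p * exp (\<i> * t * L p) - integral {p..q} (\<lambda>x. g' x * exp (\<i> * t * L x)))) {p..q}"
      using has_integral_diff[OF ftc integrable_integral[OF i2]] by (simp add: algebra_simps)
    hence eq: "(\<i> * t) * integral {p..q} (\<lambda>x. g x * L' x * exp (\<i> * t * L x)) =
        g q * exp (\<i> * t * L q) - g p * exp (\<i> * t * L p) - integral {p..q} (\<lambda>x. g' x * exp (\<i> * t * L x))"
      unfolding integral_mult_right[symmetric] by (rule integral_unique)
    have n1: "norm (exp (\<i> * t * L x)) = 1" for x
    proof -
      have "\<i> * t * L x = \<i> * of_real (t * L x)" by simp
      thus ?thesis by (simp only: norm_exp_i_times)
    qed
    have "norm (integral {p..q} (\<lambda>x. g' x * exp (\<i> * t * L x))) \<le> integral {p..q} (\<lambda>x. norm (g' x))"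
      by (rule integral_norm_bound_integral[OF i2])
         (use g'c in \<open>auto intro!: integrable_continuous_interval continuous_intros simp: norm_mult n1\<close>)
    hence "\<bar>t\<bar> * norm (integral {p..q} (\<lambda>x. g x * L' x * exp (\<i> * t * L x))) \<le> K"
    proof -
      have "\<bar>t\<bar> * norm (integral {p..q} (\<lambda>x. g x * L' x * exp (\<i> * t * L x))) = 
        norm (g q * exp (\<i> * t * L q) - g p * exp (\<i> * t * L p) - integral {p..q} (\<lambda>x. g' x * exp (\<i> * t * L x)))"
        unfolding eq[symmetric] by (simp add: norm_mult)
      also have "\<dots> \<le> norm (g q * exp (\<i> * t * L q)) + norm (g p * exp (\<i> * t * L p)) + norm (integral {p..q} (\<lambda>x. g' x * exp (\<i> * t * L x)))"
        by (meson add_mono_thms_linordered_semiring(3) norm_triangle_ineq4 order_trans)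
      also have "\<dots> \<le> K"
        unfolding K_def norm_mult n1 using \<open>norm (integral {p..q} (\<lambda>x. g' x * exp (\<i> * t * L x))) \<le> _\<close> by simp
      finally show ?thesis .
    qed
    thus ?thesis using t by (simp add: field_simps)
  qed
  have "((\<lambda>t::real. K / \<bar>t\<bar>) \<longlongrightarrow> 0) at_infinity"
    using tendsto_mult_right_zero[OF tendsto_norm_zero[OF tendsto_inverse_0[where 'a=real]], of K]
    by (simp add: divide_inverse abs_inverse)
  moreover have "\<forall>\<^sub>F t::real in at_infinity. norm (integral {p..q} (\<lambda>x. g x * L' x * exp (\<i> * t * L x))) \<le> K / \<bar>t\<bar>"
    using eventually_not_equal_at_infinity[of "0::real"] by eventually_elim (rule bound)
  ultimately show ?thesis by (rule Lim_null_comparison[rotated])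
qed

text \<open>
  Continuous amplitudes are uniform limits of polynomials, which are smooth enough to integrate by
  parts; the error is at most the uniform distance times the integral of \<open>\<bar>L'\<bar>\<close>, uniformly in \<open>t\<close>.
\<close>
lemma oscillatory_integral_continuous:
  fixes L L' :: "real \<Rightarrow> real" and h :: "real \<Rightarrow> complex"
  assumes "p \<le> q" and L: "\<And>x. (L has_real_derivative L' x) (at x)"
    and L'c: "continuous_on UNIV L'" and h: "continuous_on {p..q} h"
  shows "((\<lambda>t::real. integral {p..q} (\<lambda>x. h x * L' x * exp (\<i> * t * L x))) \<longlongrightarrow> 0) at_infinity"
proof (rule tendstoI)
  fix e :: real assume e: "e > 0"
  have Lc: "continuous_on S L" for S
    using L by (meson DERIV_isCont continuous_at_imp_continuous_on)
  have L'c': "continuous_on S L'" for S using L'c continuous_on_subset by blast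
  define K where "K = integral {p..q} (\<lambda>x. \<bar>L' x\<bar>)"
  have K: "K \<ge> 0" unfolding K_def by (intro integral_nonneg integrable_continuous_interval continuous_intros L'c') auto
  define \<delta> where "\<delta> = e / (2 * (K + 1))"
  have \<delta>: "\<delta> > 0" using e K by (simp add: \<delta>_def)
  obtain g where g: "polynomial_function g" "\<And>x. x \<in> {p..q} \<Longrightarrow> norm (h x - g x) < \<delta>"
    using Stone_Weierstrass_polynomial_function[OF compact_Icc h \<delta>] by blast
  obtain g' where g': "polynomial_function g'" "\<And>x. (g has_vector_derivative g' x) (at x)"
    using has_vector_derivative_polynomial_function[OF g(1)] by blast
  have gc: "continuous_on S g" for S using g(1) by (rule continuous_on_polymonial_function)
  have "((\<lambda>t::real. integral {p..q} (\<lambda>x. g x * L' x * exp (\<i> * t * L x))) \<longlongrightarrow> 0) at_infinity"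
    by (rule oscillatory_integral_by_parts[OF assms(1-3) g'(2)]) (rule continuous_on_polymonial_function[OF g'(1)])
  hence "\<forall>\<^sub>F t::real in at_infinity. norm (integral {p..q} (\<lambda>x. g x * L' x * exp (\<i> * t * L x))) < e / 2"
    using e by (auto dest!: tendstoD[where e = "e/2"] simp: dist_norm)
  thus "\<forall>\<^sub>F t::real in at_infinity. dist (integral {p..q} (\<lambda>x. h x * L' x * exp (\<i> * t * L x))) 0 < e"
  proof eventually_elim
    case (elim t)
    have n1: "norm (exp (\<i> * t * L x)) = 1" for x
    proof -
      have "\<i> * t * L x = \<i> * of_real (t * L x)" by simp
      thus ?thesis by (simp only: norm_exp_i_times)
    qed
    have ih: "(\<lambda>x. h x * L' x * exp (\<i> * t * L x)) integrable_on {p..q}"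
      and ig: "(\<lambda>x. g x * L' x * exp (\<i> * t * L x)) integrable_on {p..q}"
      by (intro integrable_continuous_interval continuous_intros h gc Lc L'c')+
    have "norm (integral {p..q} (\<lambda>x. h x * L' x * exp (\<i> * t * L x) - g x * L' x * exp (\<i> * t * L x)))
       \<le> integral {p..q} (\<lambda>x. \<delta> * \<bar>L' x\<bar>)"
    proof (rule integral_norm_bound_integral)
      show "(\<lambda>x. \<delta> * \<bar>L' x\<bar>) integrable_on {p..q}"
        by (intro integrable_continuous_interval continuous_intros L'c')
      fix x assume x: "x \<in> {p..q}"
      have "norm (h x * L' x * exp (\<i> * t * L x) - g x * L' x * exp (\<i> * t * L x)) = norm (h x - g x) * \<bar>L' x\<bar>"
        by (simp only: left_diff_distrib[symmetric] norm_mult n1) simp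
      also have "\<dots> \<le> \<delta> * \<bar>L' x\<bar>" using g(2)[OF x] by (intro mult_right_mono) auto
      finally show "norm (h x * L' x * exp (\<i> * t * L x) - g x * L' x * exp (\<i> * t * L x)) \<le> \<delta> * \<bar>L' x\<bar>" .
    qed (intro integrable_diff ih ig)
    also have "\<dots> = \<delta> * K" by (simp add: K_def)
    also have "\<dots> < e / 2" using e K by (simp add: \<delta>_def field_simps)
    finally have "norm (integral {p..q} (\<lambda>x. h x * L' x * exp (\<i> * t * L x)) - integral {p..q} (\<lambda>x. g x * L' x * exp (\<i> * t * L x))) < e / 2"
      by (simp add: integral_diff[OF ih ig])
    with elim show ?case by norm
  qed
qed

text \<open>
  The quotient \<open>f / L'\<close> is undefined at critical points of the phase. Replacing
  \<open>f\<close> by \<open>f L'\<^sup>2 / (L'\<^sup>2 + \<epsilon>)\<close> makes it continuous, and dominated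
  convergence shows that this changes \<open>f\<close> little in \<open>L\<^sup>1\<close>, as the critical points are finite in number.
\<close>
lemma riemann_lebesgue_phase:
  fixes L L' :: "real \<Rightarrow> real" and f :: "real \<Rightarrow> complex"
  assumes "p \<le> q" and L: "\<And>x. (L has_real_derivative L' x) (at x)"
    and L'c: "continuous_on UNIV L'" and f: "continuous_on {p..q} f"
    and fin: "finite {x \<in> {p..q}. L' x = 0}"
  shows "((\<lambda>t::real. integral {p..q} (\<lambda>x. f x * exp (\<i> * t * L x))) \<longlongrightarrow> 0) at_infinity"
proof (rule tendstoI)
  fix e :: real assume e: "e > 0"
  have Lc: "continuous_on S L" for S
    using L by (meson DERIV_isCont continuous_at_imp_continuous_on)
  have L'c': "continuous_on S L'" for S using L'c continuous_on_subset by blast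
  define d where "d = (\<lambda>n::nat. \<lambda>x. (L' x)\<^sup>2 + inverse (real (Suc n)))"
  have d: "d n x > 0" for n x unfolding d_def by (intro add_nonneg_pos) auto
  \<comment> \<open>\<open>r n\<close> is the absolute value of \<open>f - f L'\<^sup>2 / (L'\<^sup>2 + 1 / Suc n)\<close>.\<close>
  define r where "r = (\<lambda>n x. norm (f x) * (inverse (real (Suc n)) / d n x))"
  have rc: "continuous_on {p..q} (r n)" for n
    unfolding r_def d_def by (intro continuous_intros f L'c' ballI) (metis d d_def less_irrefl)
  have "(\<lambda>n. integral {p..q} (r n)) \<longlonglongrightarrow> integral {p..q} (\<lambda>x. if L' x = 0 then norm (f x) else 0)"
  proof (rule dominated_convergence(2))
    show "r n integrable_on {p..q}" for n by (intro integrable_continuous_interval rc)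
    show "(\<lambda>x. norm (f x)) integrable_on {p..q}" by (intro integrable_continuous_interval continuous_intros f)
    show "norm (r n x) \<le> norm (f x)" for n x
    proof -
      define c where "c = inverse (real (Suc n)) / d n x"
      have c: "0 \<le> c" "c \<le> 1" using d[of n x] by (simp_all add: c_def d_def field_simps)
      have "r n x = norm (f x) * c" by (simp only: r_def c_def)
      with c show ?thesis by (simp add: abs_mult mult_left_le)
    qed
    show "(\<lambda>n. r n x) \<longlonglongrightarrow> (if L' x = 0 then norm (f x) else 0)" for x
    proof (cases "L' x = 0")
      case True
      have "r n x = norm (f x)" for n unfolding r_def d_def True by simp
      thus ?thesis using True by simp
    next
      case False
      have "(\<lambda>n. r n x) \<longlonglongrightarrow> norm (f x) * (0 / ((L' x)\<^sup>2 + 0))"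
        unfolding r_def d_def using False by (intro tendsto_intros LIMSEQ_inverse_real_of_nat) auto
      thus ?thesis using False by simp
    qed
  qed
  moreover have "integral {p..q} (\<lambda>x. if L' x = 0 then norm (f x) else 0) = 0"
    by (rule integral_unique, rule has_integral_spike_finite[OF fin _ has_integral_0]) auto
  ultimately have "\<forall>\<^sub>F n in sequentially. \<bar>integral {p..q} (r n)\<bar> < e / 2"
    using e by (auto dest!: tendstoD[where e = "e/2"] simp: dist_norm)
  then obtain n where n: "\<bar>integral {p..q} (r n)\<bar> < e / 2" by (meson eventually_sequentially order_refl)
  define h where "h = (\<lambda>x. f x * of_real (L' x / d n x))"
  have hc: "continuous_on {p..q} h"
    unfolding h_def d_def by (intro continuous_intros f L'c' ballI) (metis d d_def less_irrefl)
  have "\<forall>\<^sub>F t::real in at_infinity. norm (integral {p..q} (\<lambda>x. h x * L' x * exp (\<i> * t * L x))) < e / 2"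
    using tendstoD[OF oscillatory_integral_continuous[OF assms(1-3) hc], of "e/2"] e by (simp add: dist_norm)
  thus "\<forall>\<^sub>F t::real in at_infinity. dist (integral {p..q} (\<lambda>x. f x * exp (\<i> * t * L x))) 0 < e"
  proof eventually_elim
    case (elim t)
    have n1: "norm (exp (\<i> * t * L x)) = 1" for x
    proof -
      have "\<i> * t * L x = \<i> * of_real (t * L x)" by simp
      thus ?thesis by (simp only: norm_exp_i_times)
    qed
    have ih: "(\<lambda>x. h x * L' x * exp (\<i> * t * L x)) integrable_on {p..q}"
      and iff: "(\<lambda>x. f x * exp (\<i> * t * L x)) integrable_on {p..q}"
      by (intro integrable_continuous_interval continuous_intros f hc Lc L'c')+
    have "norm (integral {p..q} (\<lambda>x. f x * exp (\<i> * t * L x) - h x * L' x * exp (\<i> * t * L x)))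
       \<le> integral {p..q} (r n)"
    proof (rule integral_norm_bound_integral)
      show "r n integrable_on {p..q}" by (intro integrable_continuous_interval rc)
      fix x assume x: "x \<in> {p..q}"
      have "1 - L' x / d n x * L' x = inverse (real (Suc n)) / d n x"
      proof -
        have "d n x - L' x * L' x = inverse (real (Suc n))" by (simp add: d_def power2_eq_square)
        moreover have "1 - L' x / d n x * L' x = (d n x - L' x * L' x) / d n x"
          using d[of n x] by (simp add: diff_divide_distrib)
        ultimately show ?thesis by simp
      qed
      hence "f x - h x * L' x = f x * of_real (inverse (real (Suc n)) / d n x)"
        unfolding h_def by (metis (no_types, opaque_lifting) mult.assoc mult.right_neutral of_real_1 of_real_diff of_real_mult right_diff_distrib)
      hence "norm (f x - h x * L' x) = r n x"
        unfolding r_def using d[of n x] by (simp add: norm_mult norm_divide norm_inverse del: of_nat_Suc of_real_divide of_real_inverse)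
      thus "norm (f x * exp (\<i> * t * L x) - h x * L' x * exp (\<i> * t * L x)) \<le> r n x"
        by (simp only: left_diff_distrib[symmetric] norm_mult n1)
    qed (intro integrable_diff ih iff)
    hence "norm (integral {p..q} (\<lambda>x. f x * exp (\<i> * t * L x)) - integral {p..q} (\<lambda>x. h x * L' x * exp (\<i> * t * L x))) < e / 2"
      using n by (simp add: integral_diff[OF iff ih])
    with elim show ?case by norm
  qed
qed

section \<open>The Dirichlet kernel\<close>

definition dirichlet_kernel :: "nat \<Rightarrow> real \<Rightarrow> complex" where
  "dirichlet_kernel M \<theta> = (\<Sum>N = - int M..int M. exp (- \<i> * of_int N * of_real \<theta>))"

lemma dirichlet_kernel_times_sin:
  "dirichlet_kernel M \<theta> * of_real (sin (\<theta> / 2)) =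
     (exp (\<i> * of_real (real M + 1/2) * of_real \<theta>) - exp (\<i> * of_real (- (real M + 1/2)) * of_real \<theta>)) / (2 * \<i>)"
proof -
  define u where "u = (\<lambda>r::real. exp (\<i> * of_real r * of_real \<theta>))"
  have mult: "u a * u b = u (a + b)" for a b
    unfolding u_def by (simp add: exp_add [symmetric] algebra_simps)
  have D: "dirichlet_kernel M \<theta> = (\<Sum>N = - int M..int M. u (- of_int N))"
    unfolding dirichlet_kernel_def u_def by simp
  have s: "of_real (sin (\<theta> / 2)) = (u (1/2) - u (-1/2)) / (2 * \<i>)"
    unfolding u_def sin_of_real[symmetric] sin_exp_eq by (simp add: algebra_simps)
  have "(\<Sum>N = - int M..int M. u (- of_int N)) * (u (1/2) - u (-1/2)) = u (real M + 1/2) - u (- (real M + 1/2))"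
  proof (induction M)
    case 0
    have "u 0 = 1" by (simp add: u_def)
    thus ?case by simp
  next
    case (Suc M)
    have "{- int (Suc M)..int (Suc M)} = insert (- int (Suc M)) (insert (int (Suc M)) {- int M..int M})" by auto
    hence "(\<Sum>N = - int (Suc M)..int (Suc M). u (- of_int N)) = u (real (Suc M)) + u (- real (Suc M)) + (\<Sum>N = - int M..int M. u (- of_int N))"
      by (simp add: add_ac)
    hence "(\<Sum>N = - int (Suc M)..int (Suc M). u (- of_int N)) * (u (1/2) - u (-1/2)) =
       (u (real (Suc M)) + u (- real (Suc M))) * (u (1/2) - u (-1/2)) + (u (real M + 1/2) - u (- (real M + 1/2)))"
      using Suc by (simp add: ring_distribs)
    also have "\<dots> = u (real (Suc M) + 1/2) - u (- (real (Suc M) + 1/2))"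
      unfolding distrib_right right_diff_distrib mult by (simp add: algebra_simps minus_diff_commute)
    finally show ?case .
  qed
  thus ?thesis unfolding D s by (simp add: u_def)
qed

lemma dirichlet_kernel_conv_cos:
  "dirichlet_kernel M \<theta> = of_real (1 + (\<Sum>n = 1..M. 2 * cos (real n * \<theta>)))"
proof (induction M)
  case 0
  show ?case by (simp add: dirichlet_kernel_def)
next
  case (Suc M)
  have "{- int (Suc M)..int (Suc M)} = insert (- int (Suc M)) (insert (int (Suc M)) {- int M..int M})" by auto
  hence "dirichlet_kernel (Suc M) \<theta> = exp (\<i> * of_real (real (Suc M) * \<theta>)) + exp (- \<i> * of_real (real (Suc M) * \<theta>)) + dirichlet_kernel M \<theta>"
    unfolding dirichlet_kernel_def by (simp add: algebra_simps)
  also have "exp (\<i> * of_real (real (Suc M) * \<theta>)) + exp (- \<i> * of_real (real (Suc M) * \<theta>)) = of_real (2 * cos (real (Suc M) * \<theta>))"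
    by (simp only: of_real_mult cos_of_real[symmetric] cos_exp_eq) simp
  finally show ?case using Suc by simp
qed

text \<open>
  The primitive of the Dirichlet kernel; its limit is a staircase with steps of height
  \<open>2 \<pi>\<close> at the points of \<open>2 \<pi> \<int>\<close>.
\<close>
definition dirichlet_primitive :: "nat \<Rightarrow> real \<Rightarrow> real" where
  "dirichlet_primitive M \<theta> = \<theta> + (\<Sum>n = 1..M. 2 * sin (real n * \<theta>) / real n)"

lemma dirichlet_primitive_deriv:
  "((\<lambda>\<theta>. of_real (dirichlet_primitive M \<theta>)) has_vector_derivative dirichlet_kernel M \<theta>) (at \<theta>)"
proof -
  have "(dirichlet_primitive M has_real_derivative (1 + (\<Sum>n = 1..M. 2 * cos (real n * \<theta>)))) (at \<theta>)"
    unfolding dirichlet_primitive_def by (auto intro!: derivative_eq_intros sum.cong)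
  thus ?thesis unfolding dirichlet_kernel_conv_cos by (rule has_vector_derivative_of_real)
qed

lemma continuous_on_dirichlet_kernel [continuous_intros]:
  "continuous_on S f \<Longrightarrow> continuous_on S (\<lambda>x. dirichlet_kernel M (f x))"
  unfolding dirichlet_kernel_def by (intro continuous_intros)

text \<open>
  Times \<open>sin (L / 2)\<close> the kernel becomes the difference of the two pure oscillations of frequencies
  \<open>\<plusminus> (M + 1 / 2)\<close>, to which the Riemann--Lebesgue lemma applies.
\<close>
lemma dirichlet_kernel_null:
  fixes L L' :: "real \<Rightarrow> real" and g :: "real \<Rightarrow> complex"
  assumes "p \<le> q" and L: "\<And>x. (L has_real_derivative L' x) (at x)"
    and L'c: "continuous_on UNIV L'" and g: "continuous_on {p..q} g"
    and fin: "finite {x \<in> {p..q}. L' x = 0}"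
  shows "(\<lambda>M. integral {p..q} (\<lambda>x. dirichlet_kernel M (L x) * (of_real (sin (L x / 2)) * g x))) \<longlonglongrightarrow> 0"
proof -
  have Lc: "continuous_on S L" for S
    using L by (meson DERIV_isCont continuous_at_imp_continuous_on)
  define J where "J = (\<lambda>t::real. integral {p..q} (\<lambda>x. g x * exp (\<i> * t * L x)))"
  have J: "(J \<longlongrightarrow> 0) at_infinity"
    unfolding J_def by (rule riemann_lebesgue_phase[OF assms])
  have "(\<lambda>M. real M + 1/2) = (\<lambda>M. 1/2 + real M)" by auto
  hence "filterlim (\<lambda>M. real M + 1/2) at_top sequentially"
    using filterlim_tendsto_add_at_top[OF tendsto_const[of "1/2"] filterlim_real_sequentially] by metis
  hence f1: "filterlim (\<lambda>M. real M + 1/2) at_infinity sequentially"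
    by (rule filterlim_at_top_imp_at_infinity)
  hence f2: "filterlim (\<lambda>M. - (real M + 1/2)) at_infinity sequentially"
    by (simp only: filterlim_at_infinity_conv_norm_at_top norm_minus_cancel)
  have "(\<lambda>M. (J (real M + 1/2) - J (- (real M + 1/2))) / (2 * \<i>)) \<longlonglongrightarrow> (0 - 0) / (2 * \<i>)"
    by (intro tendsto_intros filterlim_compose[OF J f1] filterlim_compose[OF J f2]) auto
  moreover have "integral {p..q} (\<lambda>x. dirichlet_kernel M (L x) * (of_real (sin (L x / 2)) * g x))
     = (J (real M + 1/2) - J (- (real M + 1/2))) / (2 * \<i>)" for M
  proof -
    have i: "(\<lambda>x. g x * exp (\<i> * of_real t * L x)) integrable_on {p..q}" for t :: real
      by (intro integrable_continuous_interval continuous_intros g Lc)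
    have "dirichlet_kernel M (L x) * (of_real (sin (L x / 2)) * g x) = 
      (g x * exp (\<i> * of_real (real M + 1/2) * L x) - g x * exp (\<i> * of_real (- (real M + 1/2)) * L x)) / (2 * \<i>)" for x
      unfolding mult.assoc[symmetric] dirichlet_kernel_times_sin by (simp add: algebra_simps diff_divide_distrib)
    hence "integral {p..q} (\<lambda>x. dirichlet_kernel M (L x) * (of_real (sin (L x / 2)) * g x)) =
       integral {p..q} (\<lambda>x. g x * exp (\<i> * of_real (real M + 1/2) * L x) - g x * exp (\<i> * of_real (- (real M + 1/2)) * L x)) / (2 * \<i>)"
      by (simp only: integral_divide)
    also have "\<dots> = (J (real M + 1/2) - J (- (real M + 1/2))) / (2 * \<i>)"
      by (simp only: integral_diff[OF i i] J_def)
    finally show ?thesis .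
  qed
  ultimately show ?thesis by simp
qed

text \<open>
  The value at \<open>\<pi>\<close> is exactly \<open>\<pi>\<close> for every \<open>M\<close>, and between \<open>\<pi>\<close> and \<open>\<beta>\<close> the kernel
  integrates to something that tends to zero because \<open>sin (\<theta> / 2)\<close> has no zero there.
\<close>
lemma dirichlet_primitive_limit:
  assumes "0 < \<beta>" "\<beta> < 2 * pi"
  shows "(\<lambda>M. dirichlet_primitive M \<beta>) \<longlonglongrightarrow> pi"
proof -
  have *: "(\<lambda>M. of_real (dirichlet_primitive M q) - of_real (dirichlet_primitive M p) :: complex) \<longlonglongrightarrow> 0"
    if pq: "0 < p" "p \<le> q" "q < 2 * pi" for p q
  proof -
    have s: "sin (x / 2) \<noteq> 0" if "x \<in> {p..q}" for x
      using sin_gt_zero[of "x/2"] that pq by auto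
    have "(\<lambda>M. integral {p..q} (\<lambda>x. dirichlet_kernel M x * (of_real (sin (x / 2)) * (1 / of_real (sin (x / 2)))))) \<longlonglongrightarrow> 0"
    proof (rule dirichlet_kernel_null[where L = "\<lambda>x. x" and L' = "\<lambda>x. 1"])
      show "continuous_on {p..q} (\<lambda>x. 1 / complex_of_real (sin (x / 2)))"
        by (intro continuous_intros) (use s in auto)
    qed (use pq in \<open>simp_all\<close>)
    moreover have "integral {p..q} (\<lambda>x. dirichlet_kernel M x * (of_real (sin (x / 2)) * (1 / of_real (sin (x / 2))))) =
       of_real (dirichlet_primitive M q) - of_real (dirichlet_primitive M p)" for M
    proof -
      have "integral {p..q} (\<lambda>x. dirichlet_kernel M x * (of_real (sin (x / 2)) * (1 / of_real (sin (x / 2))))) =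
         integral {p..q} (dirichlet_kernel M)"
        by (rule integral_cong) (use s in auto)
      also have "\<dots> = of_real (dirichlet_primitive M q) - of_real (dirichlet_primitive M p)"
        by (rule integral_unique, rule fundamental_theorem_of_calculus[OF pq(2)])
           (rule has_vector_derivative_at_within, rule dirichlet_primitive_deriv)
      finally show ?thesis .
    qed
    ultimately show ?thesis by simp
  qed
  have pi: "dirichlet_primitive M pi = pi" for M
    by (simp add: dirichlet_primitive_def)
  have "(\<lambda>M. dirichlet_primitive M \<beta> - pi) \<longlonglongrightarrow> 0"
  proof (cases "\<beta> \<le> pi")
    case True
    have "(\<lambda>M. of_real (pi - dirichlet_primitive M \<beta>) :: complex) \<longlonglongrightarrow> of_real 0"
      using *[of \<beta> pi] True assms by (simp add: pi)
    hence "(\<lambda>M. pi - dirichlet_primitive M \<beta>) \<longlonglongrightarrow> 0" unfolding tendsto_of_real_iff .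
    from tendsto_minus[OF this] show ?thesis by simp
  next
    case False
    have "(\<lambda>M. of_real (dirichlet_primitive M \<beta> - pi) :: complex) \<longlonglongrightarrow> of_real 0"
      using *[of pi \<beta>] False assms by (simp add: pi)
    thus ?thesis unfolding tendsto_of_real_iff .
  qed
  thus ?thesis by (simp add: LIM_zero_iff)
qed

lemma dirichlet_primitive_minus: "dirichlet_primitive M (- \<theta>) = - dirichlet_primitive M \<theta>"
  by (simp add: dirichlet_primitive_def sum_negf)

lemma sin_half_eq_0_iff: "sin (\<theta> / 2) = 0 \<longleftrightarrow> (\<exists>m::int. \<theta> = 2 * pi * m)"
  by (auto simp: sin_zero_iff_int2)

lemma dirichlet_kernel_periodic: "dirichlet_kernel M (\<theta> - 2 * pi * of_int m) = dirichlet_kernel M \<theta>"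
proof -
  have "exp (- \<i> * of_int N * of_real (\<theta> - 2 * pi * of_int m)) = exp (- \<i> * of_int N * of_real \<theta>)" for N
  proof -
    have "- \<i> * of_int N * of_real (\<theta> - 2 * pi * of_int m) = - \<i> * of_int N * of_real \<theta> + of_real (of_int (2 * (N * m)) * pi) * \<i>"
      by (simp add: algebra_simps)
    thus ?thesis unfolding exp_eq by blast
  qed
  thus ?thesis by (simp add: dirichlet_kernel_def)
qed

section \<open>Poisson summation along a phase\<close>

lemma has_vector_derivative_imp_slope:
  fixes f :: "real \<Rightarrow> complex"
  assumes "(f has_vector_derivative D) (at x)"
  shows "((\<lambda>y. (f y - f x) / of_real (y - x)) \<longlongrightarrow> D) (at x)"
proof -
  have "((\<lambda>y. norm (((f y - f x) - (y - x) *\<^sub>R D) /\<^sub>R norm (y - x))) \<longlongrightarrow> 0) (at x)"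
    using assms unfolding has_vector_derivative_def has_derivative_def
    by (intro tendsto_norm_zero) simp
  moreover have "\<forall>\<^sub>F y in at x. norm (((f y - f x) - (y - x) *\<^sub>R D) /\<^sub>R norm (y - x))
     = norm ((f y - f x) / of_real (y - x) - D)"
  proof -
    have "norm (((f y - f x) - (y - x) *\<^sub>R D) /\<^sub>R norm (y - x)) = norm ((f y - f x) / of_real (y - x) - D)" if "y \<noteq> x" for y
    proof -
      have "(f y - f x) / of_real (y - x) - D = ((f y - f x) - (y - x) *\<^sub>R D) / of_real (y - x)"
        using that by (simp add: field_simps scaleR_conv_of_real)
      thus ?thesis by (simp only: norm_divide norm_scaleR norm_of_real) (simp add: divide_inverse mult.commute)
    qed
    thus ?thesis by (auto simp: eventually_at_filter)
  qed
  ultimately have "((\<lambda>y. norm ((f y - f x) / of_real (y - x) - D)) \<longlongrightarrow> 0) (at x)"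
    by (rule Lim_transform_eventually)
  thus ?thesis by (simp add: tendsto_norm_zero_iff LIM_zero_iff)
qed

text \<open>
  Localisation at one resonance \<open>z\<close>. The test function is split as \<open>\<psi> + c L'\<close> with
  \<open>\<psi> z = 0\<close>. The first part is divisible by \<open>sin (L / 2)\<close> and gives nothing in the limit; the
  second integrates to increments of the primitive of the kernel, each half of the interval giving \<open>\<pi>\<close>.
\<close>
lemma dirichlet_kernel_single_zero:
  fixes L L' :: "real \<Rightarrow> real" and \<phi> :: "real \<Rightarrow> complex"
  assumes z: "p < z" "z < q"
    and L: "\<And>x. (L has_real_derivative L' x) (at x)"
    and L': "\<And>x. (L' has_real_derivative L'' x) (at x)"
    and \<phi>: "\<And>x. (\<phi> has_vector_derivative \<phi>' x) (at x)"
    and pos: "\<And>x. p < x \<Longrightarrow> L' x > 0"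
    and zero: "sin (L z / 2) = 0"
    and only: "\<And>x. x \<in> {p..q} \<Longrightarrow> sin (L x / 2) = 0 \<Longrightarrow> x = z"
  shows "(\<lambda>M. integral {p..q} (\<lambda>x. dirichlet_kernel M (L x) * \<phi> x)) \<longlonglongrightarrow> 2 * pi * (\<phi> z / L' z)"
proof -
  have Lc: "continuous_on S L" for S
    using L by (meson DERIV_isCont continuous_at_imp_continuous_on)
  have L'c: "continuous_on S L'" for S
    using L' by (meson DERIV_isCont continuous_at_imp_continuous_on)
  have \<phi>c: "continuous_on S \<phi>" for S
    using \<phi> by (meson has_vector_derivative_continuous continuous_at_imp_continuous_on)
  have L'z: "L' z > 0" using pos z by auto
  obtain m :: int where m: "L z = 2 * pi * m" using zero sin_half_eq_0_iff by blast
  define c where "c = \<phi> z / L' z"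
  define \<psi> where "\<psi> = (\<lambda>x. \<phi> x - c * L' x)"
  define s where "s = (\<lambda>x. complex_of_real (sin (L x / 2)))"
  define s' where "s' = cos (L z / 2) * (L' z / 2)"
  have cosz: "cos (L z / 2) \<noteq> 0" using zero sin_zero_abs_cos_one[OF zero] by auto
  have s'0: "s' \<noteq> 0" using cosz L'z by (simp add: s'_def)
  have \<psi>z: "\<psi> z = 0" using L'z by (simp add: \<psi>_def c_def)
  have sz: "s z = 0" using zero by (simp add: s_def)
  have sd: "(s has_vector_derivative of_real s') (at z)"
    unfolding s_def s'_def
    by (rule has_vector_derivative_of_real) (auto intro!: derivative_eq_intros L)
  have \<psi>d: "(\<psi> has_vector_derivative \<phi>' z - c * L'' z) (at z)"
    unfolding \<psi>_def by (intro has_vector_derivative_diff \<phi> has_vector_derivative_mult_right has_vector_derivative_of_real L')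
  \<comment> \<open>The value at \<open>z\<close> is the limit of \<open>\<psi> / s\<close>, the quotient of the two derivatives.\<close>
  define g where "g = (\<lambda>x. if x = z then (\<phi>' z - c * L'' z) / s' else \<psi> x / s x)"
  have "((\<lambda>x. ((\<psi> x - \<psi> z) / of_real (x - z)) / ((s x - s z) / of_real (x - z))) \<longlongrightarrow> (\<phi>' z - c * L'' z) / s') (at z)"
    by (intro tendsto_divide has_vector_derivative_imp_slope sd \<psi>d) (use s'0 in auto)
  moreover have "g z = (\<phi>' z - c * L'' z) / s'" by (simp add: g_def)
  ultimately have "(g \<longlongrightarrow> g z) (at z)"
    by (simp only:) (erule Lim_transform_eventually, auto simp: eventually_at_filter g_def \<psi>z sz)
  hence gz: "isCont g z" by (simp add: isCont_def)
  have gc: "continuous_on {p..q} g"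
    unfolding continuous_on_eq_continuous_within
  proof
    fix x assume x: "x \<in> {p..q}"
    show "continuous (at x within {p..q}) g"
    proof (cases "x = z")
      case True
      thus ?thesis using gz continuous_at_imp_continuous_at_within by blast
    next
      case False
      hence sx: "s x \<noteq> 0" using only[OF x] by (auto simp: s_def)
      have "isCont (\<lambda>x. \<psi> x / s x) x"
      proof (rule isCont_divide)
        show "isCont \<psi> x" "isCont s x"
          using Lc[of UNIV] L'c[of UNIV] \<phi>c[of UNIV] unfolding \<psi>_def s_def continuous_on_eq_continuous_within
          by (auto intro!: continuous_intros)
      qed (rule sx)
      moreover have "\<forall>\<^sub>F y in nhds x. \<psi> y / s y = g y"
        using t1_space_nhds[OF False] by eventually_elim (simp add: g_def)
      ultimately have "isCont g x" by (subst (asm) isCont_cong)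
      thus ?thesis using continuous_at_imp_continuous_at_within by blast
    qed
  qed
  have fin: "finite {x \<in> {p..q}. L' x = 0}"
  proof (rule finite_subset)
    show "{x \<in> {p..q}. L' x = 0} \<subseteq> {p}"
    proof
      fix x assume "x \<in> {x \<in> {p..q}. L' x = 0}"
      thus "x \<in> {p}" using pos[of x] by (cases "p = x") auto
    qed
  qed auto
  have null: "(\<lambda>M. integral {p..q} (\<lambda>x. dirichlet_kernel M (L x) * (of_real (sin (L x / 2)) * g x))) \<longlonglongrightarrow> 0"
    by (rule dirichlet_kernel_null[OF _ L L'c gc fin]) (use z in auto)
  have mono: "L x < L y" if "p \<le> x" "x < y" for x y
  proof (rule DERIV_pos_imp_increasing_open[OF \<open>x < y\<close> _ Lc])
    fix u assume "x < u" "u < y"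
    thus "\<exists>y. (L has_real_derivative y) (at u) \<and> 0 < y" using L pos \<open>p \<le> x\<close> by (meson less_le_trans not_less order_le_less_trans)
  qed
  have sin0: "sin (L x / 2) = 0" if "L x = 2 * pi * of_int k" for x k
    using that sin_half_eq_0_iff by blast
  \<comment> \<open>As \<open>z\<close> is the only resonance, \<open>L\<close> stays strictly within one period on either side of \<open>z\<close>.\<close>
  have q1: "0 < L q - 2 * pi * m" using mono[of z q] z m by simp
  have q2: "L q - 2 * pi * m < 2 * pi"
  proof (rule ccontr)
    assume "\<not> ?thesis"
    hence "L z \<le> 2 * pi * of_int (m + 1)" "2 * pi * of_int (m + 1) \<le> L q"
      using m by (auto simp: algebra_simps)
    then obtain x where x: "z \<le> x" "x \<le> q" "L x = 2 * pi * of_int (m + 1)"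
      using IVT'[of L z _ q] Lc z by force
    hence "x = z" using only[of x] sin0[OF x(3)] z by auto
    thus False using x(3) m by (simp add: distrib_left)
  qed
  have p1: "0 < 2 * pi * m - L p" using mono[of p z] z m by simp
  have p2: "2 * pi * m - L p < 2 * pi"
  proof (rule ccontr)
    assume "\<not> ?thesis"
    hence "L p \<le> 2 * pi * of_int (m - 1)" "2 * pi * of_int (m - 1) \<le> L z"
      using m by (auto simp: algebra_simps)
    then obtain x where x: "p \<le> x" "x \<le> z" "L x = 2 * pi * of_int (m - 1)"
      using IVT'[of L p _ z] Lc z by force
    hence "x = z" using only[of x] sin0[OF x(3)] z by auto
    thus False using x(3) m by (simp add: right_diff_distrib)
  qed
  have main: "((\<lambda>x. dirichlet_kernel M (L x) * L' x) has_integral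
      of_real (dirichlet_primitive M (L q - 2 * pi * m) + dirichlet_primitive M (2 * pi * m - L p))) {p..q}" for M
  proof -
    have "((\<lambda>x. L' x *\<^sub>R dirichlet_kernel M (L x - 2 * pi * m)) has_integral
      (of_real (dirichlet_primitive M (L q - 2 * pi * m)) - of_real (dirichlet_primitive M (L p - 2 * pi * m)))) {p..q}"
    proof (rule fundamental_theorem_of_calculus)
      show "p \<le> q" using z by simp
      fix x
      have "((\<lambda>x. L x - 2 * pi * m) has_vector_derivative L' x) (at x)"
        unfolding has_real_derivative_iff_has_vector_derivative[symmetric]
        by (auto intro!: derivative_eq_intros L)
      from vector_diff_chain_at[OF this dirichlet_primitive_deriv]
      show "((\<lambda>x. complex_of_real (dirichlet_primitive M (L x - 2 * pi * m))) has_vector_derivative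
         L' x *\<^sub>R dirichlet_kernel M (L x - 2 * pi * m)) (at x within {p..q})"
        by (simp add: o_def has_vector_derivative_at_within)
    qed
    moreover have "dirichlet_primitive M (L p - 2 * pi * m) = - dirichlet_primitive M (2 * pi * m - L p)"
      by (metis dirichlet_primitive_minus minus_diff_eq)
    ultimately show ?thesis
      by (simp only: dirichlet_kernel_periodic scaleR_conv_of_real mult.commute[of "of_real _" "dirichlet_kernel M _"]
        of_real_minus of_real_add diff_minus_eq_add)
  qed
  have "(\<lambda>M. c * of_real (dirichlet_primitive M (L q - 2 * pi * m) + dirichlet_primitive M (2 * pi * m - L p)) +
      integral {p..q} (\<lambda>x. dirichlet_kernel M (L x) * (of_real (sin (L x / 2)) * g x))) \<longlonglongrightarrow> c * of_real (pi + pi) + 0"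
    by (intro tendsto_intros null dirichlet_primitive_limit p1 p2 q1 q2)
  moreover have "integral {p..q} (\<lambda>x. dirichlet_kernel M (L x) * \<phi> x) = 
     c * of_real (dirichlet_primitive M (L q - 2 * pi * m) + dirichlet_primitive M (2 * pi * m - L p)) +
      integral {p..q} (\<lambda>x. dirichlet_kernel M (L x) * (of_real (sin (L x / 2)) * g x))" for M
  proof -
    have dec: "dirichlet_kernel M (L x) * \<phi> x = c * (dirichlet_kernel M (L x) * L' x) + dirichlet_kernel M (L x) * (of_real (sin (L x / 2)) * g x)"
      if "x \<in> {p..q}" for x
    proof -
      have "of_real (sin (L x / 2)) * g x = \<psi> x"
      proof (cases "x = z")
        case True
        thus ?thesis by (simp only: zero \<psi>z of_real_0 mult_zero_left)
      next
        case False
        hence "s x \<noteq> 0" using only[OF that] by (auto simp: s_def)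
        thus ?thesis using False by (simp add: g_def s_def)
      qed
      thus ?thesis unfolding \<psi>_def by (simp only:) (simp add: algebra_simps)
    qed
    have i: "(\<lambda>x. dirichlet_kernel M (L x) * (of_real (sin (L x / 2)) * g x)) integrable_on {p..q}"
      by (intro integrable_continuous_interval continuous_intros gc Lc) auto
    have "integral {p..q} (\<lambda>x. dirichlet_kernel M (L x) * \<phi> x) = integral {p..q} (\<lambda>x. c * (dirichlet_kernel M (L x) * L' x) + dirichlet_kernel M (L x) * (of_real (sin (L x / 2)) * g x))"
      by (rule integral_cong) (rule dec)
    also have "\<dots> = c * of_real (dirichlet_primitive M (L q - 2 * pi * m) + dirichlet_primitive M (2 * pi * m - L p)) +
      integral {p..q} (\<lambda>x. dirichlet_kernel M (L x) * (of_real (sin (L x / 2)) * g x))"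
      by (rule integral_unique[OF has_integral_add[OF has_integral_mult_right[OF main] integrable_integral[OF i]]])
    finally show ?thesis .
  qed
  moreover have "c * of_real (pi + pi) + 0 = 2 * pi * (\<phi> z / L' z)" by (simp add: c_def)
  ultimately show ?thesis by (simp only:)
qed

text \<open>
  On the positive half-line the phase is injective and maps resonances to points of \<open>2 \<pi> \<int>\<close> in a
  bounded interval.
\<close>
lemma finite_resonances:
  fixes L L' :: "real \<Rightarrow> real"
  assumes L: "\<And>x. (L has_real_derivative L' x) (at x)" and pos: "\<And>x. 0 < x \<Longrightarrow> L' x > 0" and "0 \<le> p"
  shows "finite {x \<in> {p..q}. sin (L x / 2) = 0}"
proof -
  have Lc: "continuous_on S L" for S
    using L by (meson DERIV_isCont continuous_at_imp_continuous_on)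
  have mono: "L x < L y" if "0 \<le> x" "x < y" for x y
  proof (rule DERIV_pos_imp_increasing_open[OF \<open>x < y\<close> _ Lc])
    fix u assume "x < u" "u < y"
    thus "\<exists>y. (L has_real_derivative y) (at u) \<and> 0 < y" using L pos \<open>0 \<le> x\<close> by (meson less_le_trans not_less order_le_less_trans)
  qed
  have inj: "inj_on L {p..q}"
  proof (rule linorder_inj_onI')
    fix x y assume "x \<in> {p..q}" "y \<in> {p..q}" "x < y"
    thus "L x \<noteq> L y" using mono[of x y] \<open>0 \<le> p\<close> by auto
  qed
  have "L ` {x \<in> {p..q}. sin (L x / 2) = 0} \<subseteq> (\<lambda>m::int. 2 * pi * m) ` {\<lfloor>L p / (2 * pi)\<rfloor>..\<lceil>L q / (2 * pi)\<rceil>}"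
  proof
    fix y assume "y \<in> L ` {x \<in> {p..q}. sin (L x / 2) = 0}"
    then obtain x where x: "y = L x" "p \<le> x" "x \<le> q" "sin (L x / 2) = 0" by auto
    then obtain m :: int where m: "L x = 2 * pi * m" using sin_half_eq_0_iff by blast
    have "L p \<le> L x" "L x \<le> L q"
      using mono[of p x] mono[of x q] x \<open>0 \<le> p\<close> by (cases "p = x"; cases "x = q"; simp)+
    hence "L p / (2 * pi) \<le> m" "m \<le> L q / (2 * pi)" unfolding m by (simp_all add: field_simps)
    hence "m \<in> {\<lfloor>L p / (2 * pi)\<rfloor>..\<lceil>L q / (2 * pi)\<rceil>}" by (simp add: floor_le_iff le_ceiling_iff)
    thus "y \<in> (\<lambda>m::int. 2 * pi * m) ` {\<lfloor>L p / (2 * pi)\<rfloor>..\<lceil>L q / (2 * pi)\<rceil>}" using m x by auto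
  qed
  hence "finite (L ` {x \<in> {p..q}. sin (L x / 2) = 0})" by (rule finite_subset) auto
  thus ?thesis by (rule finite_imageD) (rule inj_on_subset[OF inj], auto)
qed

lemma dirichlet_kernel_no_zero:
  fixes L L' :: "real \<Rightarrow> real" and \<phi> :: "real \<Rightarrow> complex"
  assumes "p \<le> q"
    and L: "\<And>x. (L has_real_derivative L' x) (at x)"
    and L'c: "continuous_on UNIV L'" and \<phi>: "continuous_on {p..q} \<phi>"
    and fin: "finite {x \<in> {p..q}. L' x = 0}"
    and nz: "\<And>x. x \<in> {p..q} \<Longrightarrow> sin (L x / 2) \<noteq> 0"
  shows "(\<lambda>M. integral {p..q} (\<lambda>x. dirichlet_kernel M (L x) * \<phi> x)) \<longlonglongrightarrow> 0"
proof -
  have Lc: "continuous_on S L" for S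
    using L by (meson DERIV_isCont continuous_at_imp_continuous_on)
  have "(\<lambda>M. integral {p..q} (\<lambda>x. dirichlet_kernel M (L x) * (of_real (sin (L x / 2)) * (\<phi> x / of_real (sin (L x / 2)))))) \<longlonglongrightarrow> 0"
    by (rule dirichlet_kernel_null[OF assms(1-3) _ fin]) (intro continuous_intros Lc \<phi>, use nz in auto)
  moreover have "integral {p..q} (\<lambda>x. dirichlet_kernel M (L x) * (of_real (sin (L x / 2)) * (\<phi> x / of_real (sin (L x / 2))))) =
     integral {p..q} (\<lambda>x. dirichlet_kernel M (L x) * \<phi> x)" for M
    by (rule integral_cong) (use nz in auto)
  ultimately show ?thesis by simp
qed

text \<open>
  Induction on the number of resonances: an interval with at least two of them is cut between two
  resonances at a point that is not itself one.
\<close>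
lemma dirichlet_kernel_increasing_phase:
  fixes L L' :: "real \<Rightarrow> real" and \<phi> :: "real \<Rightarrow> complex"
  assumes L: "\<And>x. (L has_real_derivative L' x) (at x)"
    and L': "\<And>x. (L' has_real_derivative L'' x) (at x)"
    and \<phi>: "\<And>x. (\<phi> has_vector_derivative \<phi>' x) (at x)"
    and pos: "\<And>x. 0 < x \<Longrightarrow> L' x > 0"
    and pq: "0 \<le> p" "p < q" "sin (L p / 2) \<noteq> 0" "sin (L q / 2) \<noteq> 0"
  shows "(\<lambda>M. integral {p..q} (\<lambda>x. dirichlet_kernel M (L x) * \<phi> x)) \<longlonglongrightarrow>
     2 * pi * (\<Sum>z | z \<in> {p..q} \<and> sin (L z / 2) = 0. \<phi> z / L' z)"
  using pq
proof (induction "card {z \<in> {p..q}. sin (L z / 2) = 0}" arbitrary: p q rule: less_induct)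
  case less
  have Lc: "continuous_on S L" for S
    using L by (meson DERIV_isCont continuous_at_imp_continuous_on)
  have L'c: "continuous_on S L'" for S
    using L' by (meson DERIV_isCont continuous_at_imp_continuous_on)
  have \<phi>c: "continuous_on S \<phi>" for S
    using \<phi> by (meson has_vector_derivative_continuous continuous_at_imp_continuous_on)
  define A where "A = (\<lambda>p q. {z \<in> {p..q}. sin (L z / 2) = 0})"
  have finA: "finite (A a b)" if "0 \<le> a" for a b
    unfolding A_def by (rule finite_resonances[OF L pos that])
  consider "A p q = {}" | z where "A p q = {z}" | z z' where "z \<in> A p q" "z' \<in> A p q" "z < z'"
  proof (cases "A p q = {}")
    case False
    then obtain z where z: "z \<in> A p q" by blast
    show thesis
    proof (cases "A p q = {z}")
      case False
      with z obtain z' where "z' \<in> A p q" "z' \<noteq> z" by blast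
      thus thesis using z that(3)[of z z'] that(3)[of z' z] by linarith
    qed (rule that(2))
  qed (rule that(1))
  thus ?case
  proof cases
    case 1
    have "finite {x \<in> {p..q}. L' x = 0}"
    proof (rule finite_subset)
      show "{x \<in> {p..q}. L' x = 0} \<subseteq> {p}"
      proof
        fix x assume "x \<in> {x \<in> {p..q}. L' x = 0}"
        thus "x \<in> {p}" using pos[of x] less.prems by (cases "p = x") auto
      qed
    qed auto
    moreover have "sin (L x / 2) \<noteq> 0" if "x \<in> {p..q}" for x using 1 that by (auto simp: A_def)
    ultimately have "(\<lambda>M. integral {p..q} (\<lambda>x. dirichlet_kernel M (L x) * \<phi> x)) \<longlonglongrightarrow> 0"
      using less.prems by (intro dirichlet_kernel_no_zero[OF _ L L'c \<phi>c]) simp_all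
    moreover have "{z. z \<in> {p..q} \<and> sin (L z / 2) = 0} = {}" using 1 by (simp only: A_def)
    ultimately show ?thesis by (simp only: sum.empty mult_zero_right)
  next
    case (2 z)
    hence z: "z \<in> {p..q}" "sin (L z / 2) = 0" and only: "\<And>x. x \<in> {p..q} \<Longrightarrow> sin (L x / 2) = 0 \<Longrightarrow> x = z"
      by (auto simp: A_def)
    have "p < z" "z < q" using z less.prems by (auto simp: less_le)
    hence "(\<lambda>M. integral {p..q} (\<lambda>x. dirichlet_kernel M (L x) * \<phi> x)) \<longlonglongrightarrow> 2 * pi * (\<phi> z / L' z)"
      by (rule dirichlet_kernel_single_zero[OF _ _ L L' \<phi> _ z(2)]) (use pos less.prems only in auto)
    moreover have "{z. z \<in> {p..q} \<and> sin (L z / 2) = 0} = {z}" using 2 by (simp only: A_def)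
    ultimately show ?thesis by simp
  next
    case (3 z z')
    have "infinite {z<..<z'}" using 3 by simp
    then obtain r where r: "z < r" "r < z'" "r \<notin> A p q"
      using finA[OF less.prems(1)] by (meson finite_subset greaterThanLessThan_iff subsetI)
    have rpq: "p < r" "r < q" using r 3 by (auto simp: A_def)
    have sr: "sin (L r / 2) \<noteq> 0" using r rpq by (auto simp: A_def)
    have un: "A p q = A p r \<union> A r q" and dj: "A p r \<inter> A r q = {}"
      using rpq sr by (auto simp: A_def)
    have z1: "z \<notin> A r q" and z2: "z' \<notin> A p r" using r by (auto simp: A_def)
    have "card (A p r) < card (A p q)" "card (A r q) < card (A p q)"
      using z1 z2 3(1,2) un by (intro psubset_card_mono[OF finA[OF less.prems(1)]], blast)+
    hence "(\<lambda>M. integral {p..r} (\<lambda>x. dirichlet_kernel M (L x) * \<phi> x)) \<longlonglongrightarrow> 2 * pi * (\<Sum>z\<in>A p r. \<phi> z / L' z)"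
          "(\<lambda>M. integral {r..q} (\<lambda>x. dirichlet_kernel M (L x) * \<phi> x)) \<longlonglongrightarrow> 2 * pi * (\<Sum>z\<in>A r q. \<phi> z / L' z)"
      using less.hyps[of p r] less.hyps[of r q] less.prems rpq sr by (simp_all add: A_def)
    from tendsto_add[OF this]
    have "(\<lambda>M. integral {p..r} (\<lambda>x. dirichlet_kernel M (L x) * \<phi> x) + integral {r..q} (\<lambda>x. dirichlet_kernel M (L x) * \<phi> x))
      \<longlonglongrightarrow> 2 * pi * (\<Sum>z\<in>A p q. \<phi> z / L' z)"
      unfolding un using finA less.prems rpq dj by (simp add: sum.union_disjoint distrib_left)
    moreover have "integral {p..r} (\<lambda>x. dirichlet_kernel M (L x) * \<phi> x) + integral {r..q} (\<lambda>x. dirichlet_kernel M (L x) * \<phi> x)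
       = integral {p..q} (\<lambda>x. dirichlet_kernel M (L x) * \<phi> x)" for M
      by (rule Henstock_Kurzweil_Integration.integral_combine)
         (use rpq in \<open>auto intro!: integrable_continuous_interval continuous_intros Lc \<phi>c\<close>)
    ultimately show ?thesis by (simp add: A_def)
  qed
qed

text \<open>
  The negative half-line carries no resonance, so it contributes nothing; the stationary point that
  the phase may have at \<open>0\<close> is harmless for the Riemann--Lebesgue lemma.
\<close>
theorem phase_poisson_summation:
  fixes L L' :: "real \<Rightarrow> real" and \<phi> :: "real \<Rightarrow> complex"
  assumes L: "\<And>x. (L has_real_derivative L' x) (at x)"
    and L': "\<And>x. (L' has_real_derivative L'' x) (at x)"
    and \<phi>: "\<And>x. (\<phi> has_vector_derivative \<phi>' x) (at x)"
    and pos: "\<And>x. 0 < x \<Longrightarrow> L' x > 0" and neg: "\<And>x. x < 0 \<Longrightarrow> L' x \<noteq> 0"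
    and nz: "\<And>x. x \<le> 0 \<Longrightarrow> sin (L x / 2) \<noteq> 0"
    and supp: "\<And>x. \<phi> x \<noteq> 0 \<Longrightarrow> \<bar>x\<bar> \<le> R"
  shows "(\<lambda>M. \<Sum>N = - int M..int M. (\<integral>x. exp (- \<i> * of_int N * of_real (L x)) * \<phi> x \<partial>lborel)) \<longlonglongrightarrow>
     2 * pi * (\<Sum>z | z \<in> {0..R} \<and> sin (L z / 2) = 0. \<phi> z / L' z)"
proof -
  have Lc: "continuous_on S L" for S
    using L by (meson DERIV_isCont continuous_at_imp_continuous_on)
  have L'c: "continuous_on S L'" for S
    using L' by (meson DERIV_isCont continuous_at_imp_continuous_on)
  have \<phi>c: "continuous_on S \<phi>" for S
    using \<phi> by (meson has_vector_derivative_continuous continuous_at_imp_continuous_on)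
  \<comment> \<open>The intervals of the local results must not end at a resonance: \<open>Q\<close> is a non-resonant point beyond the support.\<close>
  have "finite {x \<in> {0..\<bar>R\<bar> + 1}. sin (L x / 2) = 0}" by (rule finite_resonances[OF L pos]) auto
  moreover have "infinite {\<bar>R\<bar><..<\<bar>R\<bar> + 1}" by simp
  ultimately obtain Q where "Q \<in> {\<bar>R\<bar><..<\<bar>R\<bar> + 1}" "Q \<notin> {x \<in> {0..\<bar>R\<bar> + 1}. sin (L x / 2) = 0}"
    by (meson finite_subset subsetI)
  hence Q: "R < Q" "0 < Q" "sin (L Q / 2) \<noteq> 0" by auto
  have "(\<lambda>M. integral {-Q..0} (\<lambda>x. dirichlet_kernel M (L x) * \<phi> x)) \<longlonglongrightarrow> 0"
  proof (rule dirichlet_kernel_no_zero[OF _ L L'c \<phi>c])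
    have "{x \<in> {- Q..0}. L' x = 0} \<subseteq> {0}"
    proof
      fix x assume "x \<in> {x \<in> {- Q..0}. L' x = 0}"
      thus "x \<in> {0}" using neg[of x] by (cases "x = 0") auto
    qed
    thus "finite {x \<in> {- Q..0}. L' x = 0}" by (rule finite_subset) auto
  qed (use Q nz in auto)
  moreover have "(\<lambda>M. integral {0..Q} (\<lambda>x. dirichlet_kernel M (L x) * \<phi> x)) \<longlonglongrightarrow>
     2 * pi * (\<Sum>z | z \<in> {0..Q} \<and> sin (L z / 2) = 0. \<phi> z / L' z)"
    by (rule dirichlet_kernel_increasing_phase[OF L L' \<phi> pos]) (use Q nz in auto)
  ultimately have "(\<lambda>M. integral {-Q..0} (\<lambda>x. dirichlet_kernel M (L x) * \<phi> x) + integral {0..Q} (\<lambda>x. dirichlet_kernel M (L x) * \<phi> x)) \<longlonglongrightarrow>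
     0 + 2 * pi * (\<Sum>z | z \<in> {0..Q} \<and> sin (L z / 2) = 0. \<phi> z / L' z)" by (rule tendsto_add)
  moreover have "integral {-Q..0} (\<lambda>x. dirichlet_kernel M (L x) * \<phi> x) + integral {0..Q} (\<lambda>x. dirichlet_kernel M (L x) * \<phi> x)
       = integral {-Q..Q} (\<lambda>x. dirichlet_kernel M (L x) * \<phi> x)" for M
    by (rule Henstock_Kurzweil_Integration.integral_combine)
       (use Q in \<open>auto intro!: integrable_continuous_interval continuous_intros Lc \<phi>c\<close>)
  moreover have "integral {-Q..Q} (\<lambda>x. dirichlet_kernel M (L x) * \<phi> x) = 
     (\<Sum>N = - int M..int M. (\<integral>x. exp (- \<i> * of_int N * of_real (L x)) * \<phi> x \<partial>lborel))" for M
  proof -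
    have c: "continuous_on {-Q..Q} (\<lambda>x. exp (- \<i> * of_int N * of_real (L x)) * \<phi> x)" for N
      by (intro continuous_intros Lc \<phi>c)
    have "integral {-Q..Q} (\<lambda>x. dirichlet_kernel M (L x) * \<phi> x) =
      (\<Sum>N = - int M..int M. integral {-Q..Q} (\<lambda>x. exp (- \<i> * of_int N * of_real (L x)) * \<phi> x))"
      unfolding dirichlet_kernel_def sum_distrib_right
      by (rule integral_sum, simp, rule integrable_continuous_interval, rule c)
    also have "\<dots> = (\<Sum>N = - int M..int M. (\<integral>x. exp (- \<i> * of_int N * of_real (L x)) * \<phi> x \<partial>lborel))"
    proof (rule sum.cong)
      fix N :: int
      have "integral {-Q..Q} (\<lambda>x. exp (- \<i> * of_int N * of_real (L x)) * \<phi> x) =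
         set_lebesgue_integral lborel {-Q..Q} (\<lambda>x. exp (- \<i> * of_int N * of_real (L x)) * \<phi> x)"
        using borel_integrable_atLeastAtMost'[OF c] by (intro set_borel_integral_eq_integral(2)[symmetric])
      also have "\<dots> = (\<integral>x. exp (- \<i> * of_int N * of_real (L x)) * \<phi> x \<partial>lborel)"
        unfolding set_lebesgue_integral_def
      proof (rule Bochner_Integration.integral_cong)
        fix x
        show "indicator {-Q..Q} x *\<^sub>R (exp (- \<i> * of_int N * of_real (L x)) * \<phi> x) = exp (- \<i> * of_int N * of_real (L x)) * \<phi> x"
          using supp[of x] Q by (cases "\<phi> x = 0") (auto simp: indicator_def)
      qed simp
      finally show "integral {-Q..Q} (\<lambda>x. exp (- \<i> * of_int N * of_real (L x)) * \<phi> x) = (\<integral>x. exp (- \<i> * of_int N * of_real (L x)) * \<phi> x \<partial>lborel)" .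
    qed simp
    finally show ?thesis .
  qed
  moreover have "(\<Sum>z | z \<in> {0..Q} \<and> sin (L z / 2) = 0. \<phi> z / L' z) = (\<Sum>z | z \<in> {0..R} \<and> sin (L z / 2) = 0. \<phi> z / L' z)"
  proof (rule sum.mono_neutral_right)
    show "finite {z. z \<in> {0..Q} \<and> sin (L z / 2) = 0}"
      using finite_resonances[OF L pos, of 0 Q] by simp
    show "{z. z \<in> {0..R} \<and> sin (L z / 2) = 0} \<subseteq> {z. z \<in> {0..Q} \<and> sin (L z / 2) = 0}" using Q by auto
    have "\<phi> z = 0" if "R < z" "0 \<le> z" for z using supp[of z] that by (cases "\<phi> z = 0") auto
    thus "\<forall>z\<in>{z. z \<in> {0..Q} \<and> sin (L z / 2) = 0} - {z. z \<in> {0..R} \<and> sin (L z / 2) = 0}. \<phi> z / L' z = 0" by force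
  qed
  ultimately show ?thesis by simp
qed

section \<open>Boundedness of Ai on the positive half-line\<close>

text \<open>
  The substitution \<open>t = u ^ 3 / 3\<close> in Euler's integral. Divided by \<open>n!\<close>, these moments are
  the Taylor coefficients of \<open>Ai\<close> up to sign and a common factor, for \<open>n\<close> not congruent to \<open>2\<close> mod 3.
\<close>
lemma cubic_exponential_moment:
  fixes n :: nat
  defines "s \<equiv> (real n + 1) / 3"
  shows "(\<lambda>u::real. u ^ n * exp (- (u ^ 3) / 3)) absolutely_integrable_on {0<..}"
    and "integral {0<..} (\<lambda>u::real. u ^ n * exp (- (u ^ 3) / 3)) = 3 powr (s - 1) * Gamma s"
proof -
  have s: "s > 0" by (simp add: s_def)
  define f where "f = (\<lambda>t::real. t powr (s - 1) / exp t)"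
  have fi: "(f has_integral Gamma s) {0<..}"
  proof -
    have "((\<lambda>t. if t \<in> {0<..} then f t else 0) has_integral Gamma s) {0..}"
      by (rule has_integral_spike [of "{0}", rotated 2, OF Gamma_integral_real[OF s]]) (auto simp: f_def)
    also have "?this = ?thesis"
      by (subst has_integral_restrict) auto
    finally show ?thesis .
  qed
  have img: "(\<lambda>u::real. u ^ 3 / 3) ` {0<..} = {0<..}"
  proof (intro equalityI subsetI)
    fix t :: real assume "t \<in> {0<..}"
    hence "t = root 3 (3 * t) ^ 3 / 3" "root 3 (3 * t) \<in> {0<..}" by (simp_all add: odd_real_root_pow)
    thus "t \<in> (\<lambda>u. u ^ 3 / 3) ` {0<..}" by blast
  qed auto
  have "f absolutely_integrable_on {0<..}"
    by (rule nonnegative_absolutely_integrable_1) (use fi in \<open>auto simp: f_def integrable_on_def\<close>)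
  hence "f absolutely_integrable_on (\<lambda>u::real. u ^ 3 / 3) ` {0<..} \<and> integral ((\<lambda>u::real. u ^ 3 / 3) ` {0<..}) f = Gamma s"
    using fi by (simp add: img integral_unique)
  moreover have "inj_on (\<lambda>u::real. u ^ 3 / 3) {0<..}"
    by (auto simp: inj_on_def power_eq_iff_eq_base)
  ultimately have *: "(\<lambda>u. \<bar>u ^ 2\<bar> * f (u ^ 3 / 3)) absolutely_integrable_on {0<..} \<and>
      integral {0<..} (\<lambda>u. \<bar>u ^ 2\<bar> * f (u ^ 3 / 3)) = Gamma s"
    by (intro has_absolute_integral_change_of_variables_1'[THEN iffD2])
       (auto intro!: derivative_eq_intros)
  have eq: "u ^ n * exp (- (u ^ 3) / 3) = 3 powr (s - 1) * (\<bar>u ^ 2\<bar> * f (u ^ 3 / 3))" if "u \<in> {0<..}" for u :: real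
  proof -
    have u: "u > 0" using that by simp
    have "u ^ 2 = u powr 2" "u ^ 3 = u powr 3" using u by simp_all
    hence "u ^ 2 * (u ^ 3) powr (s - 1) = u powr (2 + 3 * (s - 1))"
      by (simp only: powr_powr powr_add)
    also have "2 + 3 * (s - 1) = real n" by (simp add: s_def field_simps)
    also have "u powr real n = u ^ n" using u by (rule powr_realpow)
    finally have 1: "u ^ 2 * (u ^ 3) powr (s - 1) = u ^ n" .
    have 2: "(u ^ 3 / 3) powr (s - 1) = (u ^ 3) powr (s - 1) / 3 powr (s - 1)"
      using u by (simp add: powr_divide)
    have 3: "exp (- (u ^ 3) / 3) = 1 / exp (u ^ 3 / 3)"
      by (simp add: exp_minus inverse_eq_divide flip: minus_divide_left)
    show ?thesis
      unfolding f_def 2 3 1[symmetric] by simp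
  qed
  have "(\<lambda>u. 3 powr (s - 1) * (\<bar>u ^ 2\<bar> * f (u ^ 3 / 3))) absolutely_integrable_on {0<..}"
    using * by (intro set_integrable_mult_right) auto
  also have "?this \<longleftrightarrow> (\<lambda>u::real. u ^ n * exp (- (u ^ 3) / 3)) absolutely_integrable_on {0<..}"
    by (rule set_integrable_cong) (use eq in auto)
  finally show "(\<lambda>u::real. u ^ n * exp (- (u ^ 3) / 3)) absolutely_integrable_on {0<..}" .
  have "integral {0<..} (\<lambda>u::real. u ^ n * exp (- (u ^ 3) / 3)) = integral {0<..} (\<lambda>u. 3 powr (s - 1) * (\<bar>u ^ 2\<bar> * f (u ^ 3 / 3)))"
    by (rule integral_cong) (rule eq)
  thus "integral {0<..} (\<lambda>u::real. u ^ n * exp (- (u ^ 3) / 3)) = 3 powr (s - 1) * Gamma s"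
    using * by simp
qed

text \<open>
  With \<open>w\<close> a primitive cube root of unity, the subseries of \<open>exp y\<close> in a fixed residue class mod 3
  is a combination of \<open>exp y\<close>, \<open>exp (w y)\<close> and \<open>exp (w\<^sup>2 y)\<close>. The growing term
  \<open>exp y\<close> cancels in the difference of the classes \<open>0\<close> and \<open>1\<close>, and
  \<open>Re w < 0\<close> bounds what is left.
\<close>
lemma trisected_exponential:
  fixes y :: real
  assumes "y \<ge> 0"
  shows "summable (\<lambda>k. y ^ (3*k) / fact (3*k) - y ^ (3*k+1) / fact (3*k+1))"
    and "\<bar>\<Sum>k. y ^ (3*k) / fact (3*k) - y ^ (3*k+1) / fact (3*k+1)\<bar> \<le> 2"
proof -
  define w where "w = Complex (- 1 / 2) (sqrt 3 / 2)"
  define \<alpha> where "\<alpha> = Complex 1 (1 / sqrt 3)"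
  have w2: "w ^ 2 = Complex (- 1 / 2) (- sqrt 3 / 2)"
    by (simp add: w_def power2_eq_square complex_eq_iff)
  have w3: "w ^ 3 = 1"
    using w2 by (simp add: power3_eq_cube w_def complex_eq_iff power2_eq_square)
  \<comment> \<open>\<open>\<alpha>\<close> is chosen such that \<open>r\<close> takes the values \<open>1, -1, 0\<close> periodically.\<close>
  define r where "r = (\<lambda>n. Re (\<alpha> * w ^ n))"
  have r3: "r (3 * k) = 1" "r (Suc (3 * k)) = -1" "r (Suc (Suc (3 * k))) = 0" for k
  proof -
    have e: "w ^ (3 * k) = 1" by (simp add: power_mult w3)
    show "r (3 * k) = 1" unfolding r_def e by (simp add: \<alpha>_def)
    show "r (Suc (3 * k)) = -1" unfolding r_def power_Suc e by (simp add: \<alpha>_def w_def)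
    have "w ^ Suc (Suc (3 * k)) = w ^ 2" unfolding power_Suc e by (simp add: power2_eq_square)
    thus "r (Suc (Suc (3 * k))) = 0" unfolding r_def by (simp add: \<alpha>_def w2)
  qed
  have "(\<lambda>n. Re (\<alpha> * ((w * of_real y) ^ n /\<^sub>R fact n))) sums Re (\<alpha> * exp (w * of_real y))"
    by (intro sums_Re sums_mult exp_converges)
  also have "(\<lambda>n. Re (\<alpha> * ((w * of_real y) ^ n /\<^sub>R fact n))) = (\<lambda>n. r n * (y ^ n / fact n))"
  proof
    fix n
    have "\<alpha> * ((w * of_real y) ^ n /\<^sub>R fact n) = (\<alpha> * w ^ n) * of_real (y ^ n / fact n)"
      by (simp add: power_mult_distrib scaleR_conv_of_real field_simps)
    thus "Re (\<alpha> * ((w * of_real y) ^ n /\<^sub>R fact n)) = r n * (y ^ n / fact n)"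
      by (simp only: r_def times_complex.sel Re_complex_of_real Im_complex_of_real mult_zero_right diff_zero)
  qed
  finally have "(\<lambda>n. r n * (y ^ n / fact n)) sums Re (\<alpha> * exp (w * of_real y))" .
  from sums_group[OF this, of 3]
  have "(\<lambda>k. \<Sum>n = k*3..<k*3+3. r n * (y ^ n / fact n)) sums Re (\<alpha> * exp (w * of_real y))" by simp
  also have "(\<lambda>k. \<Sum>n = k*3..<k*3+3. r n * (y ^ n / fact n)) = (\<lambda>k. y ^ (3*k) / fact (3*k) - y ^ (3*k+1) / fact (3*k+1))"
  proof
    fix k
    have "{k*3..<k*3+3} = {3*k, Suc (3*k), Suc (Suc (3*k))}" by auto
    thus "(\<Sum>n = k*3..<k*3+3. r n * (y ^ n / fact n)) = y ^ (3*k) / fact (3*k) - y ^ (3*k+1) / fact (3*k+1)"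
      by (simp add: r3 del: fact_Suc power_Suc)
  qed
  finally have S: "(\<lambda>k. y ^ (3*k) / fact (3*k) - y ^ (3*k+1) / fact (3*k+1)) sums Re (\<alpha> * exp (w * of_real y))" .
  show "summable (\<lambda>k. y ^ (3*k) / fact (3*k) - y ^ (3*k+1) / fact (3*k+1))" using S by (rule sums_summable)
  have "\<bar>Re (\<alpha> * exp (w * of_real y))\<bar> \<le> norm (\<alpha> * exp (w * of_real y))" by (rule abs_Re_le_cmod)
  also have "\<dots> = norm \<alpha> * exp (- y / 2)" by (simp add: norm_mult w_def)
  also have "\<dots> \<le> 2 * 1"
  proof (rule mult_mono)
    show "norm \<alpha> \<le> 2" unfolding \<alpha>_def complex_norm by (rule real_le_lsqrt) (simp_all add: power_divide)
  qed (use assms in auto)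
  finally show "\<bar>\<Sum>k. y ^ (3*k) / fact (3*k) - y ^ (3*k+1) / fact (3*k+1)\<bar> \<le> 2"
    using S by (simp add: sums_iff)
qed

lemma airy_f_sums: "(\<lambda>k. 3 ^ k * pochhammer (1/3) k / fact (3*k) * z ^ (3*k)) sums airy_f z"
  and airy_g_sums: "(\<lambda>k. 3 ^ k * pochhammer (2/3) k / fact (3*k+1) * z ^ (3*k+1)) sums airy_g z"
proof -
  have "(\<lambda>k. (\<lambda>n. (if n mod 3 = 0 then 3 ^ (n div 3) * pochhammer (of_real (1/3)) (n div 3) / fact n else 0) * z ^ n) (3*k))
     sums (\<Sum>k. 3 ^ k * pochhammer (of_real (1/3)) k / fact (3*k+0) * z ^ (3*k+0))"
    by (subst sums_mono_reindex) (use airy_aux(1)[of "1/3" 0 z] in \<open>auto simp: strict_mono_def\<close>)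
  thus "(\<lambda>k. 3 ^ k * pochhammer (1/3) k / fact (3*k) * z ^ (3*k)) sums airy_f z"
    by (simp add: airy_f_def)
  have *: "n \<in> range (\<lambda>k. 3*k+1)" if "n mod 3 = 1" for n :: nat
    by (metis mult_div_mod_eq rangeI that)
  have "(\<lambda>k. (\<lambda>n. (if n mod 3 = 1 then 3 ^ (n div 3) * pochhammer (of_real (2/3)) (n div 3) / fact n else 0) * z ^ n) (3*k+1))
     sums (\<Sum>k. 3 ^ k * pochhammer (of_real (2/3)) k / fact (3*k+1) * z ^ (3*k+1))"
    by (subst sums_mono_reindex) (use * airy_aux(1)[of "2/3" 1 z] in \<open>auto simp: strict_mono_def simp del: fact_Suc\<close>)
  moreover have "(3*k+1) mod 3 = 1" "(3*k+1) div 3 = k" for k :: nat by auto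
  ultimately show "(\<lambda>k. 3 ^ k * pochhammer (2/3) k / fact (3*k+1) * z ^ (3*k+1)) sums airy_g z"
    by (simp add: airy_g_def del: fact_Suc)
qed

text \<open>
  Integrating the Maclaurin series term by term gives
  \<open>\<Gamma>(1/3) \<Gamma>(2/3) Ai x = \<integral> exp (- u ^ 3 / 3) G (x u) du\<close> over the positive half-line, where \<open>G\<close> is
  the difference of trisected exponentials bounded in \<open>trisected_exponential\<close>. It is here that the two initial
  values of \<open>Ai\<close> have to be in the right proportion.
\<close>
lemma airy_bounded_nonneg:
  obtains B where "\<And>x::real. x \<ge> 0 \<Longrightarrow> norm (airy (of_real x)) \<le> B"
proof (rule that[of "2 * (3 powr (1/3 - 1) * Gamma (1/3)) / (Gamma (1/3) * Gamma (2/3))"])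
  fix x :: real assume x: "x \<ge> 0"
  define e where "e = (\<lambda>u::real. exp (- (u ^ 3) / 3))"
  define m where "m = (\<lambda>n. integral {0<..} (\<lambda>u::real. u ^ n * e u))"
  define K where "K = Gamma (1/3) * Gamma (2/3 :: real)"
  have K: "K > 0" unfolding K_def by (intro mult_pos_pos Gamma_real_pos) auto
  have mi: "(\<lambda>u. u ^ n * e u) absolutely_integrable_on {0<..}" for n
    unfolding e_def by (rule cubic_exponential_moment)
  have m: "m n = 3 powr ((real n + 1) / 3 - 1) * Gamma ((real n + 1) / 3)" for n
    unfolding m_def e_def by (rule cubic_exponential_moment)
  have m0: "m n \<ge> 0" for n unfolding m Gamma_real_pos by (intro mult_nonneg_nonneg) (auto intro: less_imp_le Gamma_real_pos)
  \<comment> \<open>The Maclaurin terms of \<open>K Ai x\<close> are \<open>U n\<close>, \<open>- U n\<close>, \<open>0\<close> according to the residue of \<open>n\<close> mod 3.\<close>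
  define U where "U = (\<lambda>n. x ^ n / fact n * m n)"
  have mf: "1 / (3 powr (2/3) * Gamma (2/3)) * (3 ^ k * pochhammer (1/3) k) = m (3 * k) / K" for k
  proof -
    have "pochhammer (1/3) k = Gamma (1/3 + real k) / Gamma (1/3)"
      by (rule pochhammer_Gamma) (auto elim!: nonpos_Ints_cases)
    moreover have "(real (3*k) + 1) / 3 = 1/3 + real k" by simp
    moreover have "3 powr (1/3 + real k - 1) = 3 ^ k / 3 powr (2/3)"
      by (simp add: powr_diff[symmetric] powr_realpow[symmetric])
    ultimately have "m (3 * k) = 3 ^ k / 3 powr (2/3) * Gamma (1/3 + real k)"
      unfolding m by (simp only:)
    with \<open>pochhammer _ k = _\<close> show ?thesis by (simp add: K_def)
  qed
  have mg: "1 / (3 powr (1/3) * Gamma (1/3)) * (3 ^ k * pochhammer (2/3) k) = m (3 * k + 1) / K" for k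
  proof -
    have "pochhammer (2/3) k = Gamma (2/3 + real k) / Gamma (2/3)"
      by (rule pochhammer_Gamma) (auto elim!: nonpos_Ints_cases)
    moreover have "(real (3*k+1) + 1) / 3 = 2/3 + real k" by simp
    moreover have "3 powr (2/3 + real k - 1) = 3 ^ k / 3 powr (1/3)"
      by (simp add: powr_diff[symmetric] powr_realpow[symmetric])
    ultimately have "m (3 * k + 1) = 3 ^ k / 3 powr (1/3) * Gamma (2/3 + real k)"
      unfolding m by (simp only:)
    with \<open>pochhammer _ k = _\<close> show ?thesis by (simp add: K_def)
  qed
  have poch: "pochhammer (complex_of_real a) k = of_real (pochhammer a k)" for a k
    by (rule pochhammer_of_real)
  have sf: "(\<lambda>k. of_real (U (3*k) / K)) sums (of_real (1 / (3 powr (2/3) * Gamma (2/3))) * airy_f (of_real x))"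
  proof -
    have "of_real (1 / (3 powr (2/3) * Gamma (2/3))) * (3 ^ k * pochhammer (1/3) k / fact (3*k) * of_real x ^ (3*k))
        = complex_of_real (U (3*k) / K)" for k
    proof -
      have "of_real (1 / (3 powr (2/3) * Gamma (2/3))) * (3 ^ k * pochhammer (1/3) k / fact (3*k) * of_real x ^ (3*k))
        = complex_of_real (1 / (3 powr (2/3) * Gamma (2/3)) * (3 ^ k * pochhammer (1/3) k) * (x ^ (3*k) / fact (3*k)))"
        using poch[of "1/3" k] by simp
      also have "\<dots> = of_real (U (3*k) / K)" unfolding mf U_def by (simp add: mult_ac)
      finally show ?thesis .
    qed
    with sums_mult[OF airy_f_sums[of "of_real x"], of "of_real (1 / (3 powr (2/3) * Gamma (2/3)))"] show ?thesis by (simp only:)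
  qed
  have sg: "(\<lambda>k. of_real (U (3*k+1) / K)) sums (of_real (1 / (3 powr (1/3) * Gamma (1/3))) * airy_g (of_real x))"
  proof -
    have "of_real (1 / (3 powr (1/3) * Gamma (1/3))) * (3 ^ k * pochhammer (2/3) k / fact (3*k+1) * of_real x ^ (3*k+1))
        = complex_of_real (U (3*k+1) / K)" for k
    proof -
      have "of_real (1 / (3 powr (1/3) * Gamma (1/3))) * (3 ^ k * pochhammer (2/3) k / fact (3*k+1) * of_real x ^ (3*k+1))
        = complex_of_real (1 / (3 powr (1/3) * Gamma (1/3)) * (3 ^ k * pochhammer (2/3) k) * (x ^ (3*k+1) / fact (3*k+1)))"
        using poch[of "2/3" k] by (simp del: fact_Suc power_Suc)
      also have "\<dots> = of_real (U (3*k+1) / K)" unfolding mg U_def by (simp add: mult_ac del: fact_Suc power_Suc)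
      finally show ?thesis .
    qed
    with sums_mult[OF airy_g_sums[of "of_real x"], of "of_real (1 / (3 powr (1/3) * Gamma (1/3)))"] show ?thesis by (simp only:)
  qed
  have "summable (\<lambda>k. complex_of_real (U (3*k) / K))" "summable (\<lambda>k. complex_of_real (U (3*k+1) / K))"
    using sf sg by (auto simp: sums_iff)
  hence sU: "summable (\<lambda>k. U (3*k))" "summable (\<lambda>k. U (3*k+1))"
    unfolding summable_of_real_iff using K by simp_all
  have ai: "(\<lambda>k. of_real ((U (3*k) - U (3*k+1)) / K)) sums airy (of_real x)"
    using sums_diff[OF sf sg] by (simp add: airy_def diff_divide_distrib)
  define t where "t = (\<lambda>n u. indicator {0<..} u * (x ^ n / fact n * (u ^ n * e u)))"
  have ti: "integrable lebesgue (t n)" and tI: "(\<integral>u. t n u \<partial>lebesgue) = U n" for n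
  proof -
    have "set_integrable lebesgue {0<..} (\<lambda>u. x ^ n / fact n * (u ^ n * e u))"
      by (intro set_integrable_mult_right mi)
    thus i: "integrable lebesgue (t n)" by (simp add: set_integrable_def t_def)
    have "(\<integral>u. t n u \<partial>lebesgue) = (LINT u : {0<..} | lebesgue. x ^ n / fact n * (u ^ n * e u))"
      by (simp only: set_lebesgue_integral_def t_def real_scaleR_def)
    also have "\<dots> = x ^ n / fact n * (LINT u : {0<..} | lebesgue. u ^ n * e u)"
      by (rule set_integral_mult_right)
    also have "(LINT u : {0<..} | lebesgue. u ^ n * e u) = m n"
      unfolding m_def by (rule set_lebesgue_integral_eq_integral(2)[OF mi])
    finally show "(\<integral>u. t n u \<partial>lebesgue) = U n" by (simp add: U_def)
  qed
  have t0: "t n u \<ge> 0" for n u using x by (auto simp: t_def e_def indicator_def)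
  define f where "f = (\<lambda>k u. t (3*k) u - t (3*k+1) u)"
  have fi: "integrable lebesgue (f k)" for k unfolding f_def by (intro Bochner_Integration.integrable_diff ti)
  have fI: "(\<integral>u. f k u \<partial>lebesgue) = U (3*k) - U (3*k+1)" for k
    unfolding f_def by (subst Bochner_Integration.integral_diff) (auto simp: ti tI)
  have fe: "f k u = indicator {0<..} u * e u * ((x * u) ^ (3*k) / fact (3*k) - (x * u) ^ (3*k+1) / fact (3*k+1))" for k u
    unfolding f_def t_def by (simp add: algebra_simps power_mult_distrib del: fact_Suc)
  have exp_sum: "summable (\<lambda>k. y ^ (3*k) / fact (3*k))" "summable (\<lambda>k. y ^ (3*k+1) / fact (3*k+1))" if "y \<ge> 0" for y :: real
  proof -
    have s: "summable (\<lambda>n. y ^ n / fact n)" using summable_exp[of y] by (simp add: divide_inverse mult.commute)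
    have "summable ((\<lambda>n. y ^ n / fact n) \<circ> g)" if "strict_mono g" for g
      by (rule summable_reindex[OF s]) (use that \<open>y \<ge> 0\<close> in \<open>auto simp: strict_mono_imp_inj_on\<close>)
    from this[of "\<lambda>k. 3*k"] this[of "\<lambda>k. 3*k+1"]
    show "summable (\<lambda>k. y ^ (3*k) / fact (3*k))" "summable (\<lambda>k. y ^ (3*k+1) / fact (3*k+1))"
      by (simp_all add: o_def strict_mono_def del: fact_Suc power_Suc)
  qed
  have st: "summable (\<lambda>k. t (3*k) u)" "summable (\<lambda>k. t (3*k+1) u)" for u
  proof -
    have eq: "t n u = indicator {0<..} u * e u * ((x * \<bar>u\<bar>) ^ n / fact n)" for n
      by (auto simp: t_def indicator_def power_mult_distrib)
    have y: "x * \<bar>u\<bar> \<ge> 0" using x by simp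
    show "summable (\<lambda>k. t (3*k) u)" "summable (\<lambda>k. t (3*k+1) u)"
      unfolding eq by (rule summable_mult[OF exp_sum(1)[OF y]], rule summable_mult[OF exp_sum(2)[OF y]])
  qed
  have fn: "norm (f k u) \<le> t (3*k) u + t (3*k+1) u" for k u
    using t0[of "3*k" u] t0[of "3*k+1" u] by (simp add: f_def abs_le_iff)
  have sum1: "AE u in lebesgue. summable (\<lambda>k. norm (f k u))"
  proof (rule AE_I2)
    fix u
    show "summable (\<lambda>k. norm (f k u))"
      by (rule summable_comparison_test'[OF summable_add[OF st(1)[of u] st(2)[of u]], of 0]) (use fn in simp)
  qed
  have sum2: "summable (\<lambda>k. \<integral>u. norm (f k u) \<partial>lebesgue)"
  proof (rule summable_comparison_test'[OF summable_add[OF sU], of 0])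
    fix k :: nat
    have "(\<integral>u. norm (f k u) \<partial>lebesgue) \<le> (\<integral>u. t (3*k) u + t (3*k+1) u \<partial>lebesgue)"
      by (intro integral_mono Bochner_Integration.integrable_norm fi Bochner_Integration.integrable_add ti fn)
    also have "\<dots> = U (3*k) + U (3*k+1)" by (subst Bochner_Integration.integral_add) (auto simp: ti tI)
    finally show "norm (\<integral>u. norm (f k u) \<partial>lebesgue) \<le> U (3*k) + U (3*k+1)" by (simp add: integral_nonneg)
  qed
  have sI: "(\<lambda>k. U (3*k) - U (3*k+1)) sums (\<integral>u. (\<Sum>k. f k u) \<partial>lebesgue)"
    using sums_integral[OF fi sum1 sum2] by (simp only: fI)
  define h where "h = (\<lambda>u. indicator {0<..} u * (u ^ 0 * e u))"
  have hi: "integrable lebesgue h"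
    using mi[of 0] by (simp add: set_integrable_def h_def)
  have hI: "(\<integral>u. h u \<partial>lebesgue) = m 0"
    using set_lebesgue_integral_eq_integral(2)[OF mi[of 0]] by (simp add: m_def h_def set_lebesgue_integral_def)
  have "norm (\<integral>u. (\<Sum>k. f k u) \<partial>lebesgue) \<le> (\<integral>u. 2 * h u \<partial>lebesgue)"
  proof (rule Bochner_Integration.integral_norm_bound_integral)
    show "integrable lebesgue (\<lambda>u. \<Sum>k. f k u)" by (rule integrable_suminf[OF fi sum1 sum2])
    show "integrable lebesgue (\<lambda>u. 2 * h u)" using hi by simp
    fix u :: real
    show "norm (\<Sum>k. f k u) \<le> 2 * h u"
    proof (cases "u > 0")
      case True
      hence y: "x * u \<ge> 0" using x by simp
      have "(\<Sum>k. f k u) = e u * (\<Sum>k. (x * u) ^ (3*k) / fact (3*k) - (x * u) ^ (3*k+1) / fact (3*k+1))"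
        unfolding fe using True by (subst suminf_mult[OF trisected_exponential(1)[OF y], symmetric]) simp
      hence "norm (\<Sum>k. f k u) = e u * \<bar>\<Sum>k. (x * u) ^ (3*k) / fact (3*k) - (x * u) ^ (3*k+1) / fact (3*k+1)\<bar>"
        by (simp add: abs_mult e_def del: fact_Suc power_Suc)
      also have "\<dots> \<le> e u * 2"
        by (rule mult_left_mono[OF trisected_exponential(2)[OF y]]) (simp add: e_def)
      finally show ?thesis using True by (simp add: h_def)
    next
      case False
      thus ?thesis by (simp add: fe h_def)
    qed
  qed
  hence I: "norm (\<integral>u. (\<Sum>k. f k u) \<partial>lebesgue) \<le> 2 * m 0" using hI by simp
  have "(\<lambda>k. complex_of_real ((U (3*k) - U (3*k+1)) / K)) sums of_real ((\<integral>u. (\<Sum>k. f k u) \<partial>lebesgue) / K)"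
    by (intro sums_of_real sums_divide sI)
  with ai have "airy (of_real x) = of_real ((\<integral>u. (\<Sum>k. f k u) \<partial>lebesgue) / K)" by (rule sums_unique2)
  hence "norm (airy (of_real x)) = norm (\<integral>u. (\<Sum>k. f k u) \<partial>lebesgue) / K"
    using K by (simp add: norm_divide)
  also have "\<dots> \<le> 2 * m 0 / K" using I K by (intro divide_right_mono) auto
  finally show "norm (airy (of_real x)) \<le> 2 * (3 powr (1/3 - 1) * Gamma (1/3)) / (Gamma (1/3) * Gamma (2/3))"
    by (simp add: m K_def)
qed

section \<open>The rotated Airy functions and the phase\<close>

lemma pochhammer_third_of_real:
  "pochhammer (1/3 :: complex) k = of_real (pochhammer (1/3) k)"
  "pochhammer (2/3 :: complex) k = of_real (pochhammer (2/3) k)"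
  using pochhammer_of_real[of "1/3" k, where 'a=complex] pochhammer_of_real[of "2/3" k, where 'a=complex] by simp_all

lemma airy_cnj: "airy (cnj z) = cnj (airy z)"
proof -
  have "(\<lambda>k. cnj (3 ^ k * pochhammer (1/3) k / fact (3*k) * z ^ (3*k))) sums cnj (airy_f z)"
    by (subst sums_cnj) (rule airy_f_sums)
  hence "(\<lambda>k. 3 ^ k * pochhammer (1/3) k / fact (3*k) * cnj z ^ (3*k)) sums cnj (airy_f z)"
    by (simp add: pochhammer_third_of_real)
  from sums_unique2[OF this airy_f_sums] have f: "airy_f (cnj z) = cnj (airy_f z)" by simp
  have "(\<lambda>k. cnj (3 ^ k * pochhammer (2/3) k / fact (3*k+1) * z ^ (3*k+1))) sums cnj (airy_g z)"
    by (subst sums_cnj) (rule airy_g_sums)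
  hence "(\<lambda>k. 3 ^ k * pochhammer (2/3) k / fact (3*k+1) * cnj z ^ (3*k+1)) sums cnj (airy_g z)"
    by (simp add: pochhammer_third_of_real del: fact_Suc power_Suc)
  from sums_unique2[OF this airy_g_sums] have g: "airy_g (cnj z) = cnj (airy_g z)" by simp
  show ?thesis by (simp add: airy_def f g)
qed

lemma airy_has_field_derivative: "(airy has_field_derivative deriv airy z) (at z)"
  using airy_ode(1) by (meson UNIV_I holomorphic_derivI open_UNIV)

lemma deriv_airy_has_field_derivative: "(deriv airy has_field_derivative z * airy z) (at z)"
proof -
  have "deriv airy holomorphic_on UNIV" by (intro holomorphic_deriv airy_ode(1)) auto
  hence "(deriv airy has_field_derivative deriv (deriv airy) z) (at z)"
    by (meson UNIV_I holomorphic_derivI open_UNIV)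
  thus ?thesis by (simp add: airy_ode(2))
qed

lemma deriv_airy_cnj: "deriv airy (cnj z) = cnj (deriv airy z)"
proof -
  have "(cnj \<circ> airy \<circ> cnj has_field_derivative cnj (deriv airy z)) (at (cnj z))"
    by (rule has_field_derivative_cnj_cnj) (simp only: complex_cnj_cnj airy_has_field_derivative)
  also have "cnj \<circ> airy \<circ> cnj = airy" by (simp add: airy_cnj fun_eq_iff)
  finally show ?thesis by (rule DERIV_imp_deriv)
qed

definition airy_unit :: complex where "airy_unit = exp (\<i> * of_real pi / 3)"

lemma airy_unit_sum: "airy_unit + cnj airy_unit = 1"
  and airy_unit_diff: "airy_unit - cnj airy_unit = \<i> * sqrt 3"
  and airy_unit_mult: "airy_unit * cnj airy_unit = 1"
proof -
  have "airy_unit = cis (pi / 3)" by (simp add: airy_unit_def cis_conv_exp)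
  hence u: "airy_unit = Complex (1 / 2) (sqrt 3 / 2)"
    by (simp add: complex_eq_iff cos_60 sin_60)
  show "airy_unit + cnj airy_unit = 1" "airy_unit - cnj airy_unit = \<i> * sqrt 3" "airy_unit * cnj airy_unit = 1"
    by (simp_all add: u complex_eq_iff)
qed

lemma airy_unit_cubed: "airy_unit ^ 3 = -1" "cnj airy_unit ^ 3 = -1"
proof -
  have "airy_unit ^ 3 = exp (\<i> * of_real pi)"
    unfolding airy_unit_def exp_of_nat_mult[symmetric] by simp
  thus 1: "airy_unit ^ 3 = -1" by simp
  have "cnj airy_unit ^ 3 = cnj (airy_unit ^ 3)" by simp
  thus "cnj airy_unit ^ 3 = -1" unfolding 1 by simp
qed

lemma airy_minus_alt: "airy_minus z = airy_unit * airy (airy_unit * z)"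
  and airy_plus_alt: "airy_plus z = cnj airy_unit * airy (cnj airy_unit * z)"
proof -
  have "exp (- \<i> * of_real pi / 3) = cnj airy_unit"
    by (simp add: airy_unit_def exp_cnj)
  thus "airy_plus z = cnj airy_unit * airy (cnj airy_unit * z)" by (simp only: airy_plus_def)
qed (simp add: airy_minus_def airy_unit_def)

text \<open>
  \<open>airy_f\<close> is a series in \<open>z ^ 3\<close> and \<open>airy_g\<close> is \<open>z\<close> times such a series, so a rotation by a cube
  root of \<open>-1\<close> acts as \<open>z \<mapsto> - z\<close> on the first and, up to the factor \<open>- w\<close>, on the second.
\<close>
lemma airy_rotate:
  assumes w: "w ^ 3 = -1"
  shows "airy (w * z) = of_real (1 / (3 powr (2/3) * Gamma (2/3))) * airy_f (- z)
          + of_real (1 / (3 powr (1/3) * Gamma (1/3))) * w * airy_g (- z)"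
proof -
  have p3: "(w * z) ^ (3 * k) = (- z) ^ (3 * k)" for k
    by (simp add: power_mult power_mult_distrib w)
  have "(\<lambda>k. - w * (3 ^ k * pochhammer (2/3) k / fact (3*k+1) * (- z) ^ (3*k+1))) sums (- w * airy_g (- z))"
    by (intro sums_mult airy_g_sums)
  also have "(\<lambda>k. - w * (3 ^ k * pochhammer (2/3) k / fact (3*k+1) * (- z) ^ (3*k+1))) =
     (\<lambda>k. 3 ^ k * pochhammer (2/3) k / fact (3*k+1) * (w * z) ^ (3*k+1))"
    unfolding power_add p3 by (simp add: mult_ac del: fact_Suc)
  finally have g: "airy_g (w * z) = - w * airy_g (- z)" using airy_g_sums sums_unique2 by blast
  have "airy_f (w * z) = airy_f (- z)" unfolding airy_f_def p3 ..
  thus ?thesis unfolding airy_def g by simp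
qed

lemma airy_plus_add_airy_minus: "airy_plus z + airy_minus z = airy (- z)"
proof -
  let ?w = airy_unit and ?v = "cnj airy_unit"
  have "?w ^ 2 + ?v ^ 2 = (?w + ?v) ^ 2 - 2 * (?w * ?v)" by (simp add: power2_eq_square algebra_simps)
  hence sq: "?w ^ 2 + ?v ^ 2 = -1" unfolding airy_unit_sum airy_unit_mult by simp
  define P where "P = complex_of_real (1 / (3 powr (2/3) * Gamma (2/3)))"
  define Q where "Q = complex_of_real (1 / (3 powr (1/3) * Gamma (1/3)))"
  have "airy_plus z + airy_minus z = (?w + ?v) * (P * airy_f (- z)) + (?w ^ 2 + ?v ^ 2) * (Q * airy_g (- z))"
    unfolding airy_minus_alt airy_plus_alt airy_rotate[OF airy_unit_cubed(1)] airy_rotate[OF airy_unit_cubed(2)]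
      P_def [symmetric] Q_def [symmetric]
    by (simp add: algebra_simps power2_eq_square)
  thus ?thesis unfolding sq airy_unit_sum by (simp add: airy_def P_def Q_def)
qed

lemma rotated_airy_derivs:
  assumes w: "w ^ 3 = -1" and A: "\<And>z. A z = w * airy (w * z)"
  shows "(A has_field_derivative deriv A z) (at z)"
    and "(deriv A has_field_derivative - z * A z) (at z)"
    and "deriv A z = w ^ 2 * deriv airy (w * z)"
proof -
  have 1: "(A has_field_derivative w ^ 2 * deriv airy (w * z)) (at z)" for z
    unfolding A[abs_def] by (rule derivative_eq_intros DERIV_chain2[OF airy_has_field_derivative] refl)+
      (simp add: power2_eq_square)
  hence d: "deriv A = (\<lambda>z. w ^ 2 * deriv airy (w * z))" by (intro ext DERIV_imp_deriv)
  show "(A has_field_derivative deriv A z) (at z)" "deriv A z = w ^ 2 * deriv airy (w * z)"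
    using 1 d by simp_all
  have "((\<lambda>z. w ^ 2 * deriv airy (w * z)) has_field_derivative w ^ 2 * (w * z * airy (w * z) * w)) (at z)"
    by (rule derivative_eq_intros DERIV_chain2[OF deriv_airy_has_field_derivative] refl)+ simp
  also have "w ^ 2 * (w * z * airy (w * z) * w) = w ^ 3 * z * (w * airy (w * z))"
    by (simp add: power2_eq_square power3_eq_cube algebra_simps)
  finally show "(deriv A has_field_derivative - z * A z) (at z)" by (simp add: d w A)
qed

lemmas airy_minus_derivs = rotated_airy_derivs[OF airy_unit_cubed(1) airy_minus_alt]
lemmas airy_plus_derivs = rotated_airy_derivs[OF airy_unit_cubed(2) airy_plus_alt]

lemma deriv_airy_plus_add_airy_minus: "deriv airy_plus z + deriv airy_minus z = - deriv airy (- z)"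
proof -
  have "((\<lambda>z. airy_plus z + airy_minus z) has_field_derivative deriv airy_plus z + deriv airy_minus z) (at z)"
    by (intro DERIV_add airy_plus_derivs airy_minus_derivs)
  moreover have "((\<lambda>z. airy (- z)) has_field_derivative deriv airy (- z) * (- 1)) (at z)"
    by (rule DERIV_chain2[OF airy_has_field_derivative]) (auto intro!: derivative_eq_intros)
  ultimately show ?thesis
    unfolding airy_plus_add_airy_minus using DERIV_unique by fastforce
qed

lemma deriv_airy_minus_cnj: "deriv airy_minus (of_real \<omega>) = cnj (deriv airy_plus (of_real \<omega>))"
  unfolding airy_minus_derivs(3) airy_plus_derivs(3) by (simp add: deriv_airy_cnj[symmetric])

text \<open>
  The modulus of the Wronskian of \<open>A\<^sub>+\<close> and \<open>A\<^sub>-\<close>; by the reflection formula it equals \<open>1 / (2 \<pi>)\<close>.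
\<close>
definition airy_kappa :: real where
  "airy_kappa = sqrt 3 / (3 powr (2/3) * Gamma (2/3)) / (3 powr (1/3) * Gamma (1/3))"

lemma airy_kappa_pos: "airy_kappa > 0"
  unfolding airy_kappa_def by (intro divide_pos_pos mult_pos_pos Gamma_real_pos) auto

text \<open>
  The equation \<open>A'' = - z A\<close> has no first-order term, hence the Wronskian is constant and can be
  read off at \<open>0\<close>.
\<close>
lemma airy_wronskian:
  "airy_plus z * deriv airy_minus z - deriv airy_plus z * airy_minus z = - \<i> * airy_kappa"
proof -
  define W where "W = (\<lambda>z. airy_plus z * deriv airy_minus z - deriv airy_plus z * airy_minus z)"
  have "(W has_field_derivative 0) (at z within UNIV)" for z
    unfolding W_def
    by (rule derivative_eq_intros airy_plus_derivs(1,2) airy_minus_derivs(1,2) refl)+ (simp add: algebra_simps)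
  then obtain c where c: "\<And>z. W z = c"
    using has_field_derivative_zero_constant[of UNIV W] by auto
  let ?w = airy_unit and ?v = "cnj airy_unit"
  define P where "P = complex_of_real (1 / (3 powr (2/3) * Gamma (2/3)))"
  define Q where "Q = complex_of_real (1 / (3 powr (1/3) * Gamma (1/3)))"
  have "W 0 = (?w * ?v) * (?v - ?w) * P * Q"
    unfolding W_def airy_minus_derivs(3) airy_plus_derivs(3) airy_minus_alt airy_plus_alt
      mult_zero_right airy_ode(3,4) P_def [symmetric] Q_def [symmetric]
    by (simp add: power2_eq_square algebra_simps)
  also have "?v - ?w = - (\<i> * sqrt 3)" using airy_unit_diff by (simp add: algebra_simps)
  finally have "W 0 = - \<i> * airy_kappa" unfolding airy_unit_mult by (simp add: airy_kappa_def P_def Q_def)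
  thus ?thesis using c unfolding W_def by metis
qed

text \<open>
  Since \<open>exp\<close> has no zeros, the existence of the logarithm already implies that \<open>A\<^sub>+'\<close> and \<open>A\<^sub>-'\<close> do
  not vanish on the real line. The logarithm is only given as continuous; it is differentiable because locally
  it differs from \<open>Ln\<close> of the normalised quotient by a constant. Its logarithmic derivative
  \<open>A\<^sub>-'' / A\<^sub>-' - A\<^sub>+'' / A\<^sub>+'\<close> reduces to the Wronskian by the differential equation.
\<close>
lemma airy_phase_properties:
  assumes "airy_phase L"
  obtains \<theta> \<theta>' \<theta>'' :: "real \<Rightarrow> real" where
    "\<And>x. L x = of_real (\<theta> x)"
    "\<And>x. (\<theta> has_real_derivative \<theta>' x) (at x)"
    "\<And>x. (\<theta>' has_real_derivative \<theta>'' x) (at x)"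
    "\<And>x. x > 0 \<Longrightarrow> \<theta>' x > 0" "\<And>x. x < 0 \<Longrightarrow> \<theta>' x < 0"
    "\<And>x. sin (\<theta> x / 2) = 0 \<longleftrightarrow> deriv airy (of_real (- x)) = 0"
proof -
  obtain l :: "real \<Rightarrow> complex" where lc: "continuous_on UNIV l"
    and el: "\<And>\<omega>. exp (l \<omega>) = deriv airy_minus (of_real \<omega>) / deriv airy_plus (of_real \<omega>)"
    and Ll: "\<And>\<omega>. L \<omega> = of_real pi + \<i> * l \<omega>"
    using assms unfolding airy_phase_def by auto
  define a where "a = deriv airy_minus"
  define b where "b = deriv airy_plus"
  have el': "exp (l \<omega>) = a (of_real \<omega>) / b (of_real \<omega>)" for \<omega> using el by (simp add: a_def b_def)
  have ab0: "a (of_real \<omega>) \<noteq> 0" "b (of_real \<omega>) \<noteq> 0" for \<omega> :: real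
    using el'[of \<omega>] by (auto dest: sym)
  have ab: "a (of_real \<omega>) = cnj (b (of_real \<omega>))" for \<omega> :: real
    unfolding a_def b_def by (rule deriv_airy_minus_cnj)
  have Re0: "Re (l \<omega>) = 0" for \<omega>
  proof -
    have "norm (exp (l \<omega>)) = 1" unfolding el' using ab ab0[of \<omega>] by (simp add: norm_divide)
    thus ?thesis by simp
  qed
  define \<theta> where "\<theta> = (\<lambda>\<omega>. pi - Im (l \<omega>))"
  have L\<theta>: "L x = of_real (\<theta> x)" for x
    using Re0[of x] by (simp add: Ll \<theta>_def complex_eq_iff)
  have n: "a (of_real \<omega>) * b (of_real \<omega>) = of_real ((norm (b (of_real \<omega>)))\<^sup>2)" for \<omega> :: real
    unfolding ab by (metis complex_norm_square mult.commute of_real_power)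
  define \<nu> where "\<nu> = (\<lambda>\<omega>::real. Re (a (of_real \<omega>) * b (of_real \<omega>)))"
  have \<nu>: "\<nu> \<omega> = (norm (b (of_real \<omega>)))\<^sup>2" for \<omega> unfolding \<nu>_def n by simp
  have \<nu>0: "\<nu> \<omega> > 0" for \<omega> unfolding \<nu> using ab0[of \<omega>] by simp
  define \<theta>' where "\<theta>' = (\<lambda>\<omega>. airy_kappa * \<omega> / \<nu> \<omega>)"
  have da: "(a has_field_derivative - z * airy_minus z) (at z)"
   and db: "(b has_field_derivative - z * airy_plus z) (at z)" for z
    unfolding a_def b_def by (rule airy_minus_derivs airy_plus_derivs)+
  have ld: "(l has_vector_derivative - \<i> * \<theta>' \<omega>0) (at \<omega>0)" for \<omega>0
  proof -
    let ?z = "complex_of_real \<omega>0"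
    \<comment> \<open>Dividing by the value at \<open>\<omega>0\<close> moves the argument of \<open>Ln\<close> to \<open>1\<close>, away from the branch cut.\<close>
    define q0 where "q0 = a ?z / b ?z"
    have q0: "q0 \<noteq> 0" using ab0 by (simp add: q0_def)
    have "((\<lambda>z. a z / b z) has_field_derivative
        (- ?z * airy_minus ?z * b ?z - a ?z * (- ?z * airy_plus ?z)) / (b ?z * b ?z)) (at ?z)"
      by (rule DERIV_divide[OF da db ab0(2)])
    hence "((\<lambda>z. a z / b z / q0) has_field_derivative
        (- ?z * airy_minus ?z * b ?z - a ?z * (- ?z * airy_plus ?z)) / (b ?z * b ?z) / q0) (at ?z)"
      by (rule DERIV_cdivide)
    moreover have "(Ln has_field_derivative inverse (a ?z / b ?z / q0)) (at (a ?z / b ?z / q0))"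
      by (rule has_field_derivative_Ln) (use q0 in \<open>simp add: q0_def[symmetric]\<close>)
    ultimately have "((\<lambda>z. Ln (a z / b z / q0)) has_field_derivative inverse (a ?z / b ?z / q0) *
        ((- ?z * airy_minus ?z * b ?z - a ?z * (- ?z * airy_plus ?z)) / (b ?z * b ?z) / q0)) (at ?z)"
      by (rule DERIV_chain2[rotated])
    also have "inverse (a ?z / b ?z / q0) *
        ((- ?z * airy_minus ?z * b ?z - a ?z * (- ?z * airy_plus ?z)) / (b ?z * b ?z) / q0) =
        ?z * (airy_plus ?z * a ?z - b ?z * airy_minus ?z) / (a ?z * b ?z)"
      using ab0[of \<omega>0] by (simp add: q0_def field_simps)
    also have "airy_plus ?z * a ?z - b ?z * airy_minus ?z = - \<i> * airy_kappa"
      unfolding a_def b_def by (rule airy_wronskian)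
    also have "?z * (- \<i> * airy_kappa) / (a ?z * b ?z) = - \<i> * \<theta>' \<omega>0"
      unfolding n \<theta>'_def \<nu> by simp
    finally have "((\<lambda>z. l \<omega>0 + Ln (a z / b z / q0)) has_field_derivative - \<i> * \<theta>' \<omega>0) (at ?z)"
      by (rule DERIV_add[OF DERIV_const, simplified])
    hence F: "((\<lambda>\<omega>. l \<omega>0 + Ln (a (of_real \<omega>) / b (of_real \<omega>) / q0)) has_vector_derivative - \<i> * \<theta>' \<omega>0) (at \<omega>0)"
      by (rule has_vector_derivative_real_field)
    have "isCont l \<omega>0" using lc by (simp add: continuous_on_eq_continuous_at)
    then obtain d where d: "d > 0" "\<And>\<omega>. dist \<omega> \<omega>0 < d \<Longrightarrow> dist (l \<omega>) (l \<omega>0) < pi"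
      unfolding continuous_at_eps_delta by (metis pi_gt_zero)
    show ?thesis
    proof (rule has_vector_derivative_transform_within[OF F d(1)])
      fix \<omega> assume "dist \<omega> \<omega>0 < d"
      hence "\<bar>Im (l \<omega> - l \<omega>0)\<bar> < pi"
        using d(2)[of \<omega>] abs_Im_le_cmod[of "l \<omega> - l \<omega>0"] by (simp add: dist_norm)
      hence "Ln (exp (l \<omega> - l \<omega>0)) = l \<omega> - l \<omega>0" by (intro Ln_exp) auto
      moreover have "exp (l \<omega> - l \<omega>0) = a (of_real \<omega>) / b (of_real \<omega>) / q0"
        by (simp add: exp_diff el' q0_def)
      ultimately show "l \<omega>0 + Ln (a (of_real \<omega>) / b (of_real \<omega>) / q0) = l \<omega>" by simp
    qed auto
  qed
  have d1: "(\<theta> has_real_derivative \<theta>' x) (at x)" for x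
  proof -
    have "((\<lambda>x. Im (l x)) has_vector_derivative Im (- \<i> * \<theta>' x)) (at x)"
      by (rule bounded_linear.has_vector_derivative[OF bounded_linear_Im ld])
    hence "((\<lambda>x. Im (l x)) has_real_derivative - \<theta>' x) (at x)"
      by (simp add: has_real_derivative_iff_has_vector_derivative)
    from DERIV_diff[OF DERIV_const[of pi] this] show ?thesis unfolding \<theta>_def by simp
  qed
  have "\<exists>D. (\<theta>' has_real_derivative D) (at x)" for x
  proof -
    have "((\<lambda>z. a z * b z) has_field_derivative
       (- of_real x * airy_minus (of_real x)) * b (of_real x) + (- of_real x * airy_plus (of_real x)) * a (of_real x)) (at (of_real x))"
      by (rule DERIV_mult[OF da db])
    from has_vector_derivative_real_field[OF this]
    have "(\<nu> has_vector_derivative Re ((- of_real x * airy_minus (of_real x)) * b (of_real x) + (- of_real x * airy_plus (of_real x)) * a (of_real x))) (at x)"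
      unfolding \<nu>_def by (rule bounded_linear.has_vector_derivative[OF bounded_linear_Re])
    then obtain D where D: "(\<nu> has_real_derivative D) (at x)"
      unfolding has_real_derivative_iff_has_vector_derivative[symmetric] by blast
    have k: "((\<lambda>x. airy_kappa * x) has_real_derivative airy_kappa) (at x)"
      by (auto intro!: derivative_eq_intros)
    have "\<nu> x \<noteq> 0" using \<nu>0[of x] by simp
    from DERIV_divide[OF k D this] show ?thesis unfolding \<theta>'_def by blast
  qed
  then obtain \<theta>'' where d2: "\<And>x. (\<theta>' has_real_derivative \<theta>'' x) (at x)" by metis
  have res: "sin (\<theta> x / 2) = 0 \<longleftrightarrow> deriv airy (of_real (- x)) = 0" for x
  proof -
    have "exp (- \<i> * of_real (\<theta> x)) = - exp (l x)"
    proof -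
      have "- \<i> * of_real (\<theta> x) = l x - \<i> * of_real pi"
        using Re0[of x] by (simp add: \<theta>_def complex_eq_iff)
      thus ?thesis by (simp only: exp_diff) simp
    qed
    hence "exp (- \<i> * of_real (\<theta> x)) = 1 \<longleftrightarrow> deriv airy_plus (of_real x) + deriv airy_minus (of_real x) = 0"
    proof -
      have "- (u / v) = 1 \<longleftrightarrow> v + u = 0" if "v \<noteq> 0" for u v :: complex
        using that by (auto simp: field_simps minus_equation_iff[of u] add_eq_0_iff)
      from this[OF ab0(2)[of x]] show ?thesis
        unfolding \<open>exp (- \<i> * of_real (\<theta> x)) = - exp (l x)\<close> el' by (simp only: a_def b_def)
    qed
    also have "\<dots> \<longleftrightarrow> deriv airy (of_real (- x)) = 0"
      unfolding deriv_airy_plus_add_airy_minus by simp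
    finally have 1: "exp (- \<i> * of_real (\<theta> x)) = 1 \<longleftrightarrow> deriv airy (of_real (- x)) = 0" .
    have "exp (- \<i> * of_real (\<theta> x)) = 1 \<longleftrightarrow> (\<exists>m::int. - \<theta> x = of_int (2 * m) * pi)"
      unfolding exp_eq_1 by simp
    also have "\<dots> \<longleftrightarrow> (\<exists>m::int. \<theta> x = 2 * pi * m)"
    proof
      assume "\<exists>m::int. - \<theta> x = of_int (2 * m) * pi"
      then obtain m :: int where "- \<theta> x = of_int (2 * m) * pi" by blast
      hence "\<theta> x = 2 * pi * of_int (- m)" by (simp add: mult_ac minus_equation_iff[of "\<theta> x"])
      thus "\<exists>m::int. \<theta> x = 2 * pi * m" by blast
    next
      assume "\<exists>m::int. \<theta> x = 2 * pi * m"
      then obtain m :: int where "\<theta> x = 2 * pi * m" by blast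
      hence "- \<theta> x = of_int (2 * (- m)) * pi" by simp
      thus "\<exists>m::int. - \<theta> x = of_int (2 * m) * pi" by blast
    qed
    also have "\<dots> \<longleftrightarrow> sin (\<theta> x / 2) = 0" by (auto simp: sin_zero_iff_int2)
    finally show ?thesis using 1 by blast
  qed
  show ?thesis
    by (rule that[OF L\<theta> d1 d2 _ _ res])
       (use \<nu>0 airy_kappa_pos in \<open>simp_all add: \<theta>'_def zero_less_divide_iff divide_less_0_iff zero_less_mult_iff mult_less_0_iff\<close>)
qed

section \<open>The zeros of Ai'\<close>

definition airy_re :: "real \<Rightarrow> real" where "airy_re x = Re (airy (of_real x))"
definition airy_re' :: "real \<Rightarrow> real" where "airy_re' x = Re (deriv airy (of_real x))"

lemma airy_of_real: "airy (of_real x) = of_real (airy_re x)"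
  and deriv_airy_of_real: "deriv airy (of_real x) = of_real (airy_re' x)"
proof -
  have "cnj (airy (of_real x)) = airy (of_real x)" "cnj (deriv airy (of_real x)) = deriv airy (of_real x)"
    unfolding airy_cnj[symmetric] deriv_airy_cnj[symmetric] by simp_all
  thus "airy (of_real x) = of_real (airy_re x)" "deriv airy (of_real x) = of_real (airy_re' x)"
    by (simp_all add: airy_re_def airy_re'_def complex_eq_iff)
qed

lemma airy_re_deriv: "(airy_re has_real_derivative airy_re' x) (at x)"
  and airy_re'_deriv: "(airy_re' has_real_derivative x * airy_re x) (at x)"
proof -
  have "((\<lambda>x. airy (of_real x)) has_vector_derivative deriv airy (of_real x)) (at x)"
    by (rule has_vector_derivative_real_field) (rule airy_has_field_derivative)
  from bounded_linear.has_vector_derivative[OF bounded_linear_Re this]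
  show "(airy_re has_real_derivative airy_re' x) (at x)"
    unfolding airy_re_def[abs_def] airy_re'_def has_real_derivative_iff_has_vector_derivative .
  have "((\<lambda>x. deriv airy (of_real x)) has_vector_derivative of_real x * airy (of_real x)) (at x)"
    by (rule has_vector_derivative_real_field) (rule deriv_airy_has_field_derivative)
  from bounded_linear.has_vector_derivative[OF bounded_linear_Re this]
  show "(airy_re' has_real_derivative x * airy_re x) (at x)"
    unfolding airy_re'_def[abs_def] has_real_derivative_iff_has_vector_derivative by (simp add: airy_of_real)
qed

text \<open>
  At a double zero, \<open>A\<^sub>+\<close> and \<open>A\<^sub>-\<close> would have proportional initial data, so their Wronskian would
  vanish.
\<close>
lemma airy_no_double_zero: "airy z \<noteq> 0 \<or> deriv airy z \<noteq> 0"
proof (rule ccontr)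
  assume "\<not> ?thesis"
  hence "airy_plus (- z) + airy_minus (- z) = 0" "deriv airy_plus (- z) + deriv airy_minus (- z) = 0"
    unfolding airy_plus_add_airy_minus deriv_airy_plus_add_airy_minus by simp_all
  hence "airy_minus (- z) = - airy_plus (- z)" "deriv airy_minus (- z) = - deriv airy_plus (- z)"
    by (simp_all add: add_eq_0_iff)
  hence "airy_plus (- z) * deriv airy_minus (- z) - deriv airy_plus (- z) * airy_minus (- z) = 0"
    by simp
  thus False unfolding airy_wronskian using airy_kappa_pos by simp
qed

text \<open>
  For \<open>y = Ai\<close> and \<open>x \<ge> 0\<close> the derivative \<open>y'\<^sup>2 + x y\<^sup>2\<close> of \<open>y y'\<close> is nonnegative. If \<open>y'\<close> vanished at
  \<open>x0\<close>, then \<open>y\<^sup>2\<close> would increase from \<open>x0\<close> on and hence grow at least quadratically,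
  contradicting the boundedness of \<open>Ai\<close>.
\<close>
lemma deriv_airy_nonneg_ne_0:
  assumes "x0 \<ge> 0"
  shows "deriv airy (of_real x0) \<noteq> 0"
proof
  assume z: "deriv airy (of_real x0) = 0"
  let ?y = airy_re and ?d = airy_re'
  have dz: "?d x0 = 0" using z by (simp add: deriv_airy_of_real)
  have "Gamma (1/3 :: real) > 0" by (rule Gamma_real_pos) simp
  hence "Gamma (1/3 :: real) \<noteq> 0" by (rule less_imp_neq[symmetric])
  hence "deriv airy 0 \<noteq> 0" by (simp add: airy_ode(4))
  hence x0: "x0 > 0" using z assms by (cases "x0 = 0") auto
  define s where "s = (?y x0)\<^sup>2"
  have "?y x0 \<noteq> 0" using airy_no_double_zero[of "of_real x0"] z by (auto simp: airy_of_real)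
  hence s: "s > 0" by (simp add: s_def)
  have du: "((\<lambda>x. ?y x * ?d x) has_real_derivative (?d x)\<^sup>2 + x * (?y x)\<^sup>2) (at x)" for x
    by (rule DERIV_cong[OF DERIV_mult[OF airy_re_deriv airy_re'_deriv]]) (simp add: power2_eq_square algebra_simps)
  have dq: "((\<lambda>x. (?y x)\<^sup>2) has_real_derivative 2 * (?y x * ?d x)) (at x)" for x
    by (rule DERIV_cong[OF DERIV_power[OF airy_re_deriv]]) simp
  have u0: "?y x * ?d x \<ge> 0" if "x0 \<le> x" for x
  proof -
    have "?y x0 * ?d x0 \<le> ?y x * ?d x"
      by (rule DERIV_nonneg_imp_nondecreasing[OF that]) (use du assms in \<open>fastforce intro: add_nonneg_nonneg\<close>)
    thus ?thesis by (simp add: dz)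
  qed
  have q0: "(?y x)\<^sup>2 \<ge> s" if "x0 \<le> x" for x
    unfolding s_def by (rule DERIV_nonneg_imp_nondecreasing[OF that]) (use dq u0 in fastforce)
  have u1: "?y x * ?d x \<ge> x0 * s * (x - x0)" if "x0 \<le> x" for x
  proof -
    have "?y x0 * ?d x0 - x0 * s * (x0 - x0) \<le> ?y x * ?d x - x0 * s * (x - x0)"
    proof (rule DERIV_nonneg_imp_nondecreasing[OF that])
      fix t assume t: "x0 \<le> t"
      have "((\<lambda>x. ?y x * ?d x - x0 * s * (x - x0)) has_real_derivative (?d t)\<^sup>2 + t * (?y t)\<^sup>2 - x0 * s) (at t)"
        by (rule DERIV_diff[OF du]) (auto intro!: derivative_eq_intros)
      moreover have "x0 * s \<le> t * (?y t)\<^sup>2" using q0[OF t] t x0 s by (intro mult_mono) auto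
      hence "(?d t)\<^sup>2 + t * (?y t)\<^sup>2 - x0 * s \<ge> 0" by (smt (verit) zero_le_power2)
      ultimately show "\<exists>y. ((\<lambda>x. ?y x * ?d x - x0 * s * (x - x0)) has_real_derivative y) (at t) \<and> 0 \<le> y" by blast
    qed
    thus ?thesis by (simp add: dz)
  qed
  have q1: "(?y x)\<^sup>2 \<ge> x0 * s * (x - x0)\<^sup>2" if "x0 \<le> x" for x
  proof -
    have "(?y x0)\<^sup>2 - x0 * s * (x0 - x0)\<^sup>2 \<le> (?y x)\<^sup>2 - x0 * s * (x - x0)\<^sup>2"
    proof (rule DERIV_nonneg_imp_nondecreasing[OF that])
      fix t assume t: "x0 \<le> t"
      have "((\<lambda>x. (?y x)\<^sup>2 - x0 * s * (x - x0)\<^sup>2) has_real_derivative 2 * (?y t * ?d t) - x0 * s * (2 * (t - x0))) (at t)"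
        by (rule DERIV_diff[OF dq]) (auto intro!: derivative_eq_intros)
      moreover have "2 * (?y t * ?d t) - x0 * s * (2 * (t - x0)) \<ge> 0"
        using mult_left_mono[OF u1[OF t], of 2] by (simp add: mult_ac)
      ultimately show "\<exists>y. ((\<lambda>x. (?y x)\<^sup>2 - x0 * s * (x - x0)\<^sup>2) has_real_derivative y) (at t) \<and> 0 \<le> y" by blast
    qed
    moreover have "x0 * s * (x0 - x0)\<^sup>2 = 0" by simp
    ultimately show ?thesis using zero_le_power2[of "?y x0"] by linarith
  qed
  obtain B where B: "\<And>x::real. x \<ge> 0 \<Longrightarrow> norm (airy (of_real x)) \<le> B" using airy_bounded_nonneg by blast
  \<comment> \<open>At distance \<open>t\<close> from \<open>x0\<close> the quadratic lower bound reaches \<open>B\<^sup>2 + 1\<close>.\<close>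
  define t where "t = sqrt ((B\<^sup>2 + 1) / (x0 * s))"
  have t: "t \<ge> 0" "x0 * s * t\<^sup>2 = B\<^sup>2 + 1"
    using x0 s by (simp_all add: t_def)
  have "\<bar>?y (x0 + t)\<bar> \<le> B" using B[of "x0 + t"] x0 t by (simp add: airy_of_real del: of_real_add)
  hence "(?y (x0 + t))\<^sup>2 \<le> B\<^sup>2" using abs_le_square_iff[of "?y (x0 + t)" B] by simp
  moreover have "(?y (x0 + t))\<^sup>2 \<ge> B\<^sup>2 + 1" using q1[of "x0 + t"] t by simp
  ultimately show False by simp
qed

text \<open>
  If \<open>v\<close> ever becomes positive, it stays so while it increases, and \<open>v'' = - x v\<close> stays below a
  negative constant, driving \<open>v'\<close> to zero in finite time. If \<open>v\<close> stays nonpositive, then \<open>v'\<close> is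
  nondecreasing and positive, so \<open>v\<close> must become positive after all.
\<close>
lemma no_eventually_increasing_oscillator:
  fixes v d :: "real \<Rightarrow> real"
  assumes v: "\<And>x. (v has_real_derivative d x) (at x)"
    and d: "\<And>x. (d has_real_derivative - x * v x) (at x)"
    and X: "X \<ge> 1" and pos: "\<And>x. x \<ge> X \<Longrightarrow> d x > 0"
  shows False
proof (cases "\<exists>x1\<ge>X. v x1 > 0")
  case True
  then obtain x1 where x1: "x1 \<ge> X" "v x1 > 0" by blast
  define c where "c = v x1"
  have vc: "v x \<ge> c" if "x1 \<le> x" for x
    unfolding c_def
  proof (rule DERIV_nonneg_imp_nondecreasing[OF that])
    fix t assume "x1 \<le> t"
    hence "d t > 0" using pos[of t] x1 by simp
    thus "\<exists>y. (v has_real_derivative y) (at t) \<and> 0 \<le> y" using v[of t] less_imp_le by blast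
  qed
  have "d x + c * (x - x1) \<le> d x1 + c * (x1 - x1)" if "x1 \<le> x" for x
  proof (rule DERIV_nonpos_imp_nonincreasing[OF that])
    fix t assume t: "x1 \<le> t"
    have "((\<lambda>x. d x + c * (x - x1)) has_real_derivative - t * v t + c) (at t)"
      by (rule DERIV_add[OF d]) (auto intro!: derivative_eq_intros)
    moreover have "1 * c \<le> t * v t" using vc[OF t] t x1 X by (intro mult_mono) (auto simp: c_def)
    hence "- t * v t + c \<le> 0" by simp
    ultimately show "\<exists>y. ((\<lambda>x. d x + c * (x - x1)) has_real_derivative y) (at t) \<and> y \<le> 0" by blast
  qed
  from this[of "x1 + d x1 / c"] have "d (x1 + d x1 / c) \<le> 0"
    using pos[of x1] x1 by (simp add: c_def)
  moreover have "d (x1 + d x1 / c) > 0" using pos[of x1] x1 by (intro pos) (simp add: c_def add_increasing2)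
  ultimately show False by simp
next
  case False
  hence neg: "v x \<le> 0" if "x \<ge> X" for x using that by force
  define c where "c = d X"
  have c: "c > 0" using pos[of X] by (simp add: c_def)
  have dc: "d x \<ge> c" if "X \<le> x" for x
    unfolding c_def
  proof (rule DERIV_nonneg_imp_nondecreasing[OF that])
    fix t assume t: "X \<le> t"
    have "- t * v t \<ge> 0" using neg[OF t] t X by (simp add: mult_nonneg_nonpos)
    thus "\<exists>y. (d has_real_derivative y) (at t) \<and> 0 \<le> y" using d[of t] by blast
  qed
  have "v X - c * (X - X) \<le> v x - c * (x - X)" if "X \<le> x" for x
  proof (rule DERIV_nonneg_imp_nondecreasing[OF that])
    fix t assume t: "X \<le> t"
    have "((\<lambda>x. v x - c * (x - X)) has_real_derivative d t - c) (at t)"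
      by (rule DERIV_diff[OF v]) (auto intro!: derivative_eq_intros)
    moreover have "d t - c \<ge> 0" using dc[OF t] by simp
    ultimately show "\<exists>y. ((\<lambda>x. v x - c * (x - X)) has_real_derivative y) (at t) \<and> 0 \<le> y" by blast
  qed
  from this[of "X + (1 - v X) / c"] have "v (X + (1 - v X) / c) \<ge> 1"
    using c neg[of X] by simp
  moreover have "v (X + (1 - v X) / c) \<le> 0" using c neg[of X] by (intro neg) simp
  ultimately show False by simp
qed

text \<open>
  Otherwise the derivative of \<open>Ai (- x)\<close> would have a constant sign for large \<open>x\<close>, so either
  \<open>Ai (- x)\<close> or its negative would be an eventually increasing solution of \<open>v'' = - x v\<close>.
\<close>
lemma deriv_airy_zeros_unbounded:
  obtains x where "x > X" "deriv airy (of_real (- x)) = 0"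
proof -
  define Y where "Y = max X 1 + 1"
  have "\<exists>x\<ge>Y. airy_re' (- x) = 0"
  proof (rule ccontr)
    assume "\<not> ?thesis"
    hence nz: "airy_re' (- x) \<noteq> 0" if "x \<ge> Y" for x using that by blast
    define v where "v = (\<lambda>x. airy_re (- x))"
    define d where "d = (\<lambda>x. - airy_re' (- x))"
    have v: "(v has_real_derivative d x) (at x)" for x
      unfolding v_def d_def by (rule DERIV_cong[OF DERIV_chain2[OF airy_re_deriv]]) (auto intro!: derivative_eq_intros)
    have "((\<lambda>x. airy_re' (- x)) has_real_derivative - x * airy_re (- x) * (- 1)) (at x)" for x
      by (rule DERIV_chain2[OF airy_re'_deriv]) (auto intro!: derivative_eq_intros)
    from DERIV_minus[OF this] have d: "(d has_real_derivative - x * v x) (at x)" for x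
      unfolding v_def d_def by simp
    have dc: "continuous_on S d" for S using d by (meson DERIV_isCont continuous_at_imp_continuous_on)
    have nz': "d x \<noteq> 0" if "x \<ge> Y" for x using nz[OF that] by (simp add: d_def)
    have Y: "Y \<ge> 1" by (simp add: Y_def)
    show False
    proof (cases "d Y > 0")
      case True
      have "d x > 0" if "x \<ge> Y" for x
      proof (rule ccontr)
        assume "\<not> d x > 0"
        hence "\<exists>t\<ge>Y. t \<le> x \<and> d t = 0"
          using True that by (intro IVT2' dc) simp_all
        then obtain t where "Y \<le> t" "d t = 0" by blast
        thus False using nz'[of t] by simp
      qed
      thus False by (rule no_eventually_increasing_oscillator[OF v d Y])
    next
      case False
      have neg: "- d x > 0" if "x \<ge> Y" for x
      proof (rule ccontr)
        assume "\<not> - d x > 0"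
        hence "\<exists>t\<ge>Y. t \<le> x \<and> d t = 0"
          using False that by (intro IVT' dc) simp_all
        then obtain t where "Y \<le> t" "d t = 0" by blast
        thus False using nz'[of t] by simp
      qed
      have v': "((\<lambda>x. - v x) has_real_derivative - d x) (at x)"
        and d': "((\<lambda>x. - d x) has_real_derivative - x * - v x) (at x)" for x
        using DERIV_minus[OF v[of x]] DERIV_minus[OF d[of x]] by simp_all
      show False by (rule no_eventually_increasing_oscillator[OF v' d' Y neg])
    qed
  qed
  then obtain x where "x \<ge> Y" "airy_re' (- x) = 0" by blast
  thus ?thesis using that[of x] deriv_airy_of_real[of "- x"] by (simp add: Y_def)
qed

text \<open>
  This makes the description of the \<open>k\<close>-th smallest element by a count unambiguous: a locally finite,
  unbounded set of positive reals is enumerated by its counting function.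
\<close>
lemma rank_bij_betw:
  fixes Z :: "real set"
  assumes pos: "\<And>z. z \<in> Z \<Longrightarrow> z > 0"
    and fin: "\<And>x. finite {y \<in> Z. y \<le> x}" and unb: "\<And>x. \<exists>z\<in>Z. z > x"
  shows "bij_betw (\<lambda>x. card {y \<in> Z. y \<le> x}) Z {1..}"
proof -
  let ?r = "\<lambda>x. card {y \<in> Z. y \<le> x}"
  have mono: "?r x < ?r y" if "x < y" "y \<in> Z" for x y
    by (rule psubset_card_mono[OF fin]) (use that in force)
  have inj: "inj_on ?r Z"
    by (rule linorder_inj_onI') (use mono in \<open>metis less_irrefl\<close>)
  have ex: "\<exists>x. ?r x = k \<and> (k > 0 \<longrightarrow> x \<in> Z)" for k
  proof (induction k)
    case 0
    have "{y \<in> Z. y \<le> 0} = {}" using pos by force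
    hence "?r 0 = 0" by (simp only: card.empty)
    thus ?case by blast
  next
    case (Suc k)
    then obtain x where x: "?r x = k" by blast
    obtain z where z: "z \<in> Z" "z > x" using unb by blast
    define S where "S = {y \<in> Z. x < y \<and> y \<le> z}"
    have S: "finite S" "S \<noteq> {}" using z finite_subset[OF _ fin[of z], of S] by (auto simp: S_def)
    define m where "m = Min S"
    have m: "m \<in> S" "\<And>y. y \<in> S \<Longrightarrow> m \<le> y" using S by (auto simp: m_def)
    have "{y \<in> Z. y \<le> m} = insert m {y \<in> Z. y \<le> x}"
      using m unfolding S_def by fastforce
    moreover have "m \<notin> {y \<in> Z. y \<le> x}" using m(1) by (auto simp: S_def)
    ultimately have "?r m = Suc k" using x fin[of x] by simp
    thus ?case using m(1) by (auto simp: S_def)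
  qed
  have "?r ` Z = {1..}"
  proof (intro equalityI subsetI)
    fix k assume "k \<in> ?r ` Z"
    then obtain x where "x \<in> Z" "k = ?r x" by blast
    moreover from this have "?r x > 0" using fin[of x] by (auto simp: card_gt_0_iff)
    ultimately show "k \<in> {1..}" by simp
  next
    fix k :: nat assume "k \<in> {1..}"
    with ex[of k] show "k \<in> ?r ` Z" by auto
  qed
  thus ?thesis using inj by (simp add: bij_betw_def)
qed

theorem lemma10:
  fixes L \<phi> :: "real \<Rightarrow> complex"
  assumes "airy_phase L" and "test_function \<phi>"
  shows "(\<lambda>k. 1 / vector_derivative L (at (airy_deriv_zero k)) * \<phi> (airy_deriv_zero k))
           summable_on {1..} \<and>
         (\<lambda>M::nat. \<Sum>N = - int M..int M.
            (\<integral>\<omega>. exp (- \<i> * of_int N * L \<omega>) * \<phi> \<omega> \<partial>lborel))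
         \<longlonglongrightarrow> 2 * of_real pi *
           (\<Sum>\<^sub>\<infinity>k\<in>{1..}. 1 / vector_derivative L (at (airy_deriv_zero k)) * \<phi> (airy_deriv_zero k))"
proof -
  obtain \<theta> \<theta>' \<theta>'' :: "real \<Rightarrow> real" where L: "\<And>x. L x = of_real (\<theta> x)"
    and \<theta>: "\<And>x. (\<theta> has_real_derivative \<theta>' x) (at x)"
    and \<theta>': "\<And>x. (\<theta>' has_real_derivative \<theta>'' x) (at x)"
    and pos: "\<And>x. x > 0 \<Longrightarrow> \<theta>' x > 0" and neg: "\<And>x. x < 0 \<Longrightarrow> \<theta>' x < 0"
    and res: "\<And>x. sin (\<theta> x / 2) = 0 \<longleftrightarrow> deriv airy (of_real (- x)) = 0"
    using airy_phase_properties[OF assms(1)] by blast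
  obtain D :: "nat \<Rightarrow> real \<Rightarrow> complex" where D0: "D 0 = \<phi>"
    and D: "\<And>n x. (D n has_vector_derivative D (Suc n) x) (at x)" and cpt: "compact (closure {x. \<phi> x \<noteq> 0})"
    using assms(2) unfolding test_function_def by auto
  have \<phi>: "(\<phi> has_vector_derivative D 1 x) (at x)" for x using D[of 0 x] D0 by simp
  have "bounded {x. \<phi> x \<noteq> 0}" using cpt compact_imp_bounded bounded_subset closure_subset by blast
  then obtain R where R: "\<And>x. \<phi> x \<noteq> 0 \<Longrightarrow> \<bar>x\<bar> \<le> R" unfolding bounded_iff by auto
  define Z where "Z = {x. deriv airy (of_real (- x)) = 0}"
  have Zpos: "x > 0" if "x \<in> Z" for x
    using that deriv_airy_nonneg_ne_0[of "- x"] unfolding Z_def by force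
  have Zres: "sin (\<theta> x / 2) = 0 \<longleftrightarrow> x \<in> Z" for x by (simp only: res Z_def mem_Collect_eq)
  have Zfin: "finite {y \<in> Z. y \<le> x}" for x
  proof (rule finite_subset)
    show "{y \<in> Z. y \<le> x} \<subseteq> {y \<in> {0..x}. sin (\<theta> y / 2) = 0}"
      using Zpos Zres by (auto intro: less_imp_le)
    show "finite {y \<in> {0..x}. sin (\<theta> y / 2) = 0}" by (rule finite_resonances[OF \<theta> pos]) auto
  qed
  have "\<exists>z\<in>Z. z > x" for x
    using deriv_airy_zeros_unbounded[of x] unfolding Z_def by blast
  hence bij: "bij_betw (\<lambda>x. card {y \<in> Z. y \<le> x}) Z {1..}"
    by (intro rank_bij_betw Zpos Zfin)
  have "airy_deriv_zero = the_inv_into Z (\<lambda>x. card {y \<in> Z. y \<le> x})"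
    by (intro ext) (simp add: airy_deriv_zero_def the_inv_into_def Z_def conj_commute)
  hence bz: "bij_betw airy_deriv_zero {1..} Z" using bij_betw_the_inv_into[OF bij] by simp
  define g where "g = (\<lambda>z. 1 / vector_derivative L (at z) * \<phi> z)"
  have vd: "vector_derivative L (at z) = of_real (\<theta>' z)" for z
  proof (rule vector_derivative_at)
    have "L = (\<lambda>x. of_real (\<theta> x))" using L by blast
    thus "(L has_vector_derivative of_real (\<theta>' z)) (at z)" using has_vector_derivative_of_real[OF \<theta>] by simp
  qed
  have g: "g z = \<phi> z / of_real (\<theta>' z)" for z by (simp add: g_def vd)
  define F where "F = {z. z \<in> {0..R} \<and> sin (\<theta> z / 2) = 0}"
  have F: "F = {y \<in> Z. y \<le> R}" using Zpos Zres by (auto simp: F_def intro: less_imp_le)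
  \<comment> \<open>Only the finitely many zeros in the support of \<open>\<phi>\<close> contribute to the infinite sum.\<close>
  have g0: "g z = 0" if "z \<in> Z - F" for z
    using that R[of z] Zpos[of z] unfolding F g by (cases "\<phi> z = 0") auto
  have finF: "finite F" unfolding F by (rule Zfin)
  have sumF: "(g has_sum sum g F) Z"
    by (rule has_sum_cong_neutral[THEN iffD1, OF _ _ _ has_sum_finite[OF finF]]) (use g0 F in auto)
  have "((\<lambda>k. g (airy_deriv_zero k)) has_sum sum g F) {1..}"
    using has_sum_reindex_bij_betw[OF bz, of g "sum g F"] sumF by simp
  hence S: "(\<lambda>k. g (airy_deriv_zero k)) summable_on {1..}" "(\<Sum>\<^sub>\<infinity>k\<in>{1..}. g (airy_deriv_zero k)) = sum g F"
    by (auto simp: summable_on_def infsumI)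
  have "(\<lambda>M. \<Sum>N = - int M..int M. (\<integral>x. exp (- \<i> * of_int N * of_real (\<theta> x)) * \<phi> x \<partial>lborel)) \<longlonglongrightarrow>
     2 * pi * (\<Sum>z | z \<in> {0..R} \<and> sin (\<theta> z / 2) = 0. \<phi> z / \<theta>' z)"
  proof (rule phase_poisson_summation[OF \<theta> \<theta>' \<phi> pos _ _ R])
    fix x :: real
    show "\<theta>' x \<noteq> 0" if "x < 0" using neg[OF that] by simp
    show "sin (\<theta> x / 2) \<noteq> 0" if "x \<le> 0" using Zpos[of x] that unfolding Zres by force
  qed
  hence "(\<lambda>M. \<Sum>N = - int M..int M. (\<integral>x. exp (- \<i> * of_int N * L x) * \<phi> x \<partial>lborel)) \<longlonglongrightarrow> 2 * of_real pi * sum g F"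
    unfolding L F_def[symmetric] g[symmetric] of_real_mult of_real_numeral .
  thus ?thesis using S unfolding g_def by simp
qed

end
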